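(* Let $X$ be a nonempty coarsely homogeneous separable metric space of asymptotic dimension zero. Then $X$ is macro-uniformly equivalent to one of the three spaces $1$, $2^{<\mathbb N}$, $\omega^{<\mathbb N}$. Moreover: (i) $X$ is macro-uniformly equivalent to the singleton $1$ if and only if $X$ is bounded; (ii) $X$ is macro-uniformly equivalent to the Cantor macro-cube $2^{<\mathbb N}$ if and only if $X$ is unbounded and has bounded geometry; (iii) $X$ is macro-uniformly equivalent to the Baire macro-space $\omega^{<\mathbb N}$ if and only if $X$ has unbounded geometry.
   Context: Notation: $\mathbb N=\{1,2,3,\dots\}$, $\omega=\{0,1,2,\dots\}$ (also used as the first infinite cardinal), $2=\{0,1\}$, and $1=\{0\}$ is the one-point metric space. For $\kappa\in\{2,\omega\}$, $$\kappa^{<\mathbb N}=\{(x_i)_{i\in\mathbb N}\in\kappa^{\mathbb N}:\exists n\in\mathbb N\ \forall i>n\ \ x_i=0\}$$ with the ultrametric $d((x_i),(y_i))=\max(\{0\}\cup\{i\in\mathbb N:x_i\ne y_i\})$. The space $2^{<\mathbb N}$ is called the Cantor macro-cube and $\omega^{<\mathbb N}$ the Baire macro-space. Multi-maps: a multi-map $\Phi:X\Rightarrow Y$ between sets is a subset $\Phi\subset X\times Y$. For $A\subset X$, $\Phi(A)=\{y\in Y:\exists a\in A,\ (a,y)\in\Phi\}$, $\Phi(x)=\Phi(\{x\})$, and $\Phi^{-1}=\{(y,x):(x,y)\in\Phi\}:Y\Rightarrow X$. For metric spaces $X,Y$ the oscillation of $\Phi$ is the function $\omega_\Phi:[0,\infty)\to[0,\infty]$,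 $\omega_\Phi(\delta)=\sup\{\operatorname{diam}\Phi(A):A\subset X,\ \operatorname{diam}A\le\delta\}$ (with $\operatorname{diam}\emptyset=0$). $\Phi$ is macro-uniform if $\omega_\Phi(\delta)<\infty$ for all $\delta<\infty$. $\Phi$ is a macro-uniform equivalence if $\Phi^{-1}(Y)=X$, $\Phi(X)=Y$, and both $\Phi$ and $\Phi^{-1}$ are macro-uniform. Metric spaces $X,Y$ are macro-uniformly equivalent if there is a macro-uniform equivalence $\Phi:X\Rightarrow Y$. Coarse homogeneity: a metric space $X$ is coarsely homogeneous if there is a function $\varphi:[0,\infty)\to[0,\infty)$ such that for any $x,y\in X$ there is a macro-uniform equivalence $\Phi:X\Rightarrow X$ with $y\in\Phi(x)$, $\omega_\Phi\le\varphi$ and $\omega_{\Phi^{-1}}\le\varphi$ (pointwise). Asymptotic dimension zero: for $\varepsilon\ge 0$ and $x\in X$ the $\varepsilon$-connected component $C_\varepsilon(x)$ is the set of all $y\in X$ for which there is a finite sequence $x=x_0,\dots,x_n=y$ in $X$ with $d(x_{i-1},x_i)\le\varepsilon$ for all $1\le i\le n$. $X$ has asymptotic dimension zero if $\sup_{x\in X}\operatorname{diam}C_\varepsilon(x)<\infty$ for every $\varepsilon>0$. Geometry: for $A\subset X$ and a real $\delta>0$, $\operatorname{cov}_\delta(A)$ is the smallest cardinality of a cover of $A$ by sets of diameter $\le\delta$. With $B_\varepsilon(x)=\{y\in X:d(x,y)\le\varepsilon\}$, put $\operatorname{cov}_\delta^\varepsilon(X)=\min_{x\in X}\operatorname{cov}_\delta(B_\varepsilon(x))$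 and $\operatorname{Cov}_\delta^\varepsilon(X)=\sup_{x\in X}\operatorname{cov}_\delta(B_\varepsilon(x))$ for positive reals $\delta,\varepsilon$. $X$ has bounded geometry if there is $\delta<\infty$ such that $\operatorname{Cov}_\delta^\varepsilon(X)$ is finite for every $\varepsilon<\infty$. $X$ has unbounded geometry if for every $\delta<\infty$ there is $\varepsilon<\infty$ with $\operatorname{cov}_\delta^\varepsilon(X)\ge\omega$ (i.e. no closed $\varepsilon$-ball of $X$ can be covered by finitely many sets of diameter $\le\delta$). *)

theory Defs
  imports "HOL-Analysis.Analysis"
begin

text \<open>The diameter of a set, with values in \<open>[0,\<infinity>]\<close>; the empty supremum in
  \<^typ>\<open>ennreal\<close> is 0, so the diameter of the empty set is 0.\<close>

definition mdiam :: "'a metric \<Rightarrow> 'a set \<Rightarrow> ennreal" where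
  "mdiam X A = (SUP x\<in>A. SUP y\<in>A. ennreal (mdist X x y))"

text \<open>A multi-map from \<open>X\<close> to \<open>Y\<close> is a relation \<open>\<Phi> \<subseteq> mspace X \<times> mspace Y\<close>; its values
  are the images \<open>\<Phi> `` A\<close> and its inverse is \<open>converse \<Phi>\<close>.\<close>

definition oscillation ::
  "'a metric \<Rightarrow> 'b metric \<Rightarrow> ('a \<times> 'b) set \<Rightarrow> real \<Rightarrow> ennreal" where
  "oscillation X Y \<Phi> \<delta> =
     (SUP A\<in>{A. A \<subseteq> mspace X \<and> mdiam X A \<le> ennreal \<delta>}. mdiam Y (\<Phi> `` A))"

definition macro_uniform :: "'a metric \<Rightarrow> 'b metric \<Rightarrow> ('a \<times> 'b) set \<Rightarrow> bool" where
  "macro_uniform X Y \<Phi> \<longleftrightarrow>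
     \<Phi> \<subseteq> mspace X \<times> mspace Y \<and> (\<forall>\<delta>\<ge>0. oscillation X Y \<Phi> \<delta> < \<infinity>)"

definition macro_uniform_equivalence ::
  "'a metric \<Rightarrow> 'b metric \<Rightarrow> ('a \<times> 'b) set \<Rightarrow> bool" where
  "macro_uniform_equivalence X Y \<Phi> \<longleftrightarrow>
     converse \<Phi> `` mspace Y = mspace X \<and> \<Phi> `` mspace X = mspace Y \<and>
     macro_uniform X Y \<Phi> \<and> macro_uniform Y X (converse \<Phi>)"

definition macro_uniformly_equivalent :: "'a metric \<Rightarrow> 'b metric \<Rightarrow> bool" where
  "macro_uniformly_equivalent X Y \<longleftrightarrow> (\<exists>\<Phi>. macro_uniform_equivalence X Y \<Phi>)"

definition coarsely_homogeneous :: "'a metric \<Rightarrow> bool" where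
  "coarsely_homogeneous X \<longleftrightarrow>
     (\<exists>\<phi>::real \<Rightarrow> real. (\<forall>\<delta>\<ge>0. \<phi> \<delta> \<ge> 0) \<and>
        (\<forall>x\<in>mspace X. \<forall>y\<in>mspace X. \<exists>\<Phi>. macro_uniform_equivalence X X \<Phi> \<and>
           y \<in> \<Phi> `` {x} \<and>
           (\<forall>\<delta>\<ge>0. oscillation X X \<Phi> \<delta> \<le> ennreal (\<phi> \<delta>)) \<and>
           (\<forall>\<delta>\<ge>0. oscillation X X (converse \<Phi>) \<delta> \<le> ennreal (\<phi> \<delta>))))"

definition eps_component :: "'a metric \<Rightarrow> real \<Rightarrow> 'a \<Rightarrow> 'a set" where
  "eps_component X \<epsilon> x =
     {y. \<exists>(n::nat) s. s 0 = x \<and> s n = y \<and> (\<forall>i\<le>n. s i \<in> mspace X) \<and>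
         (\<forall>i<n. mdist X (s i) (s (Suc i)) \<le> \<epsilon>)}"

definition asymptotic_dimension_zero :: "'a metric \<Rightarrow> bool" where
  "asymptotic_dimension_zero X \<longleftrightarrow>
     (\<forall>\<epsilon>>0. (SUP x\<in>mspace X. mdiam X (eps_component X \<epsilon> x)) < \<infinity>)"

text \<open>Covering numbers are valued in \<^typ>\<open>enat\<close>: \<open>\<infinity>\<close> stands for every infinite
  cardinal (the infimum over no finite covers). Nothing is lost for separable spaces,
  where every covering number with \<open>\<delta> > 0\<close> is at most \<open>\<omega>\<close>; and bounded and unbounded
  geometry only ask whether these numbers are finite.\<close>

definition cov_number :: "'a metric \<Rightarrow> real \<Rightarrow> 'a set \<Rightarrow> enat" where
  "cov_number X \<delta> A =
     (INF \<C>\<in>{\<C>. finite \<C> \<and> \<C> \<subseteq> Pow (mspace X) \<and> A \<subseteq> \<Union>\<C> \<and>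
               (\<forall>C\<in>\<C>. mdiam X C \<le> ennreal \<delta>)}. enat (card \<C>))"

definition lower_cov :: "'a metric \<Rightarrow> real \<Rightarrow> real \<Rightarrow> enat" where
  "lower_cov X \<delta> \<epsilon> = (INF x\<in>mspace X. cov_number X \<delta> (mcball_of X x \<epsilon>))"

definition upper_cov :: "'a metric \<Rightarrow> real \<Rightarrow> real \<Rightarrow> enat" where
  "upper_cov X \<delta> \<epsilon> = (SUP x\<in>mspace X. cov_number X \<delta> (mcball_of X x \<epsilon>))"

definition bounded_geometry :: "'a metric \<Rightarrow> bool" where
  "bounded_geometry X \<longleftrightarrow> (\<exists>\<delta>>0. \<forall>\<epsilon>>0. upper_cov X \<delta> \<epsilon> < \<infinity>)"

definition unbounded_geometry :: "'a metric \<Rightarrow> bool" where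
  "unbounded_geometry X \<longleftrightarrow> (\<forall>\<delta>>0. \<exists>\<epsilon>>0. lower_cov X \<delta> \<epsilon> \<ge> \<infinity>)"

definition bounded_metric :: "'a metric \<Rightarrow> bool" where
  "bounded_metric X \<longleftrightarrow> Metric_space.mbounded (mspace X) (mdist X) (mspace X)"

text \<open>Sequences are indexed by the positive integers, hence extensional functions on
  \<open>{1..}\<close> (the junk value at 0 is fixed).\<close>

definition fin_seqs :: "nat set \<Rightarrow> (nat \<Rightarrow> nat) set" where
  "fin_seqs K = {x \<in> {1..} \<rightarrow>\<^sub>E K. \<exists>n\<ge>1. \<forall>i>n. x i = 0}"

definition last_diff :: "(nat \<Rightarrow> nat) \<Rightarrow> (nat \<Rightarrow> nat) \<Rightarrow> real" where
  "last_diff x y = real (Max ({0} \<union> {i\<in>{1..}. x i \<noteq> y i}))"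

definition fin_seq_metric :: "nat set \<Rightarrow> (nat \<Rightarrow> nat) metric" where
  "fin_seq_metric K = metric (fin_seqs K, last_diff)"

definition cantor_macro_cube :: "(nat \<Rightarrow> nat) metric" where
  "cantor_macro_cube = fin_seq_metric {0, 1}"

definition baire_macro_space :: "(nat \<Rightarrow> nat) metric" where
  "baire_macro_space = fin_seq_metric UNIV"

definition singleton_metric :: "nat metric" where
  "singleton_metric = metric ({0}, \<lambda>x y. 0)"

text \<open>The constructor \<^const>\<open>metric\<close> is only meaningful on actual metrics; this is
  what the following facts establish.\<close>

lemma finite_diff_fin_seqs:
  assumes "x \<in> fin_seqs K" "y \<in> fin_seqs K"
  shows "finite {i\<in>{1..}. x i \<noteq> y i}"
proof -
  obtain m n where "\<forall>i>m. x i = 0" "\<forall>i>n. y i = 0"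
    using assms by (auto simp: fin_seqs_def)
  then have "i \<le> max m n" if "x i \<noteq> y i" for i
    using that by (cases "i > m"; cases "i > n") auto
  then have "{i\<in>{1..}. x i \<noteq> y i} \<subseteq> {..max m n}"
    by blast
  then show ?thesis
    using finite_subset by blast
qed

lemma Metric_space_fin_seqs: "Metric_space (fin_seqs K) last_diff"
proof
  show "0 \<le> last_diff x y" for x y
    by (simp add: last_diff_def)
  show "last_diff x y = last_diff y x" for x y
    by (simp add: last_diff_def eq_commute)
next
  fix x y assume xy: "x \<in> fin_seqs K" "y \<in> fin_seqs K"
  show "last_diff x y = 0 \<longleftrightarrow> x = y"
  proof
    assume "last_diff x y = 0"
    then have "Max ({0} \<union> {i\<in>{1..}. x i \<noteq> y i}) = 0"
      by (simp add: last_diff_def)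
    then have "x i = y i" if "i \<in> {1..}" for i
      using Max_ge[of "{0} \<union> {i\<in>{1..}. x i \<noteq> y i}" i] finite_diff_fin_seqs[OF xy] that
      by fastforce
    then show "x = y"
      using xy by (auto simp: fin_seqs_def intro: PiE_ext)
  qed (simp add: last_diff_def)
next
  fix x y z assume xyz: "x \<in> fin_seqs K" "y \<in> fin_seqs K" "z \<in> fin_seqs K"
  let ?D = "\<lambda>x y. {0} \<union> {i\<in>{1..}. x i \<noteq> y i}"
  have fin: "finite (?D x y)" "finite (?D y z)" "finite (?D x z)"
    using finite_diff_fin_seqs xyz by auto
  have "Max (?D x z) \<le> Max (?D x y \<union> ?D y z)"
    by (rule Max_mono) (use fin in auto)
  also have "\<dots> = max (Max (?D x y)) (Max (?D y z))"
    by (rule Max_Un) (use fin in auto)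
  finally show "last_diff x z \<le> last_diff x y + last_diff y z"
    unfolding last_diff_def by linarith
qed

lemma mspace_fin_seq_metric [simp]: "mspace (fin_seq_metric K) = fin_seqs K"
  and mdist_fin_seq_metric [simp]: "mdist (fin_seq_metric K) = last_diff"
  using Metric_space_fin_seqs
  by (simp_all add: fin_seq_metric_def Metric_space.mspace_metric Metric_space.mdist_metric)

lemma Metric_space_singleton: "Metric_space {0::nat} (\<lambda>x y. 0)"
  by (simp add: Metric_space_def)

lemma mspace_singleton_metric [simp]: "mspace singleton_metric = {0}"
  and mdist_singleton_metric [simp]: "mdist singleton_metric = (\<lambda>x y. 0)"
  using Metric_space_singleton
  by (simp_all add: singleton_metric_def Metric_space.mspace_metric Metric_space.mdist_metric)

end

theory Submission
  imports Defs
begin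

text \<open>
  In a space \<open>X\<close> of asymptotic dimension zero, the components at the scales 1, 2, 3, ... form a
  tower of nested equivalence relations with classes of uniformly bounded diameter
  (\<open>component_tower\<close>), and the coarse geometry of \<open>X\<close> is the combinatorics of this tower.

  In unbounded geometry, every class of a level splits into infinitely many classes of a fixed lower
  level once the level is high enough, and into countably many by separability. Keeping only
  suitable levels, one can label the subclasses of each class by the natural numbers and read off the digits of
  a point of the Baire macro-space (\<open>equivalent_baire\<close>).

  In bounded geometry, the numbers of subclasses are finite but may vary from class to class, so
  classes cannot be matched with balls of the Cantor macro-cube one to one. The cube is the set of natural
  numbers with its dyadic blocks (\<open>binary_coding\<close>), and \<open>X\<close> is mapped onto it by a map that
  interleaves the two towers: a class of level \<open>i\<close> goes into a block of length \<open>2 ^ m (i + 1)\<close>, and such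
  a block comes from one class of level \<open>i + 1\<close> (\<open>dyadic_coding\<close>). The map is built by filling
  a whole number of blocks with each class. A class is flexible: if it has \<open>N\<close> elements, it can be made
  to fill any number of blocks whose total length is roughly \<open>N / 2\<close>, within a relative tolerance that
  decreases with the level but stays positive. If the levels are sparse, subclasses are negligible
  in size compared with blocks, so that they can be grouped into blocks of nearly equal content
  (\<open>balanced_groups\<close>), and blocks are negligible compared with the next classes, so that rounding to
  whole blocks is harmless (\<open>choose_summands\<close>); \<open>packing\<close> combines both. What the tolerance loses
  from level to level is a convergent series.

  Homogeneity enters through covering numbers only: up to a controlled change of scales, those of
  all balls of the same radius agree (\<open>homogeneous_cov_number\<close>). Hence the geometry is either
  bounded or unbounded (\<open>homogeneous_dichotomy\<close>), and in an unbounded space the classes grow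
  uniformly (\<open>homogeneous_growth\<close>), which the sparse choice of levels requires. Conversely, boundedness and both kinds of
  geometry are invariant under macro-uniform equivalence (\<open>bounded_metric_transfer\<close>,
  \<open>bounded_geometry_transfer\<close>, \<open>unbounded_geometry_transfer\<close>), so that the models tell the
  three cases apart.
\<close>

section \<open>Towers of equivalence relations\<close>

text \<open>A metric space of asymptotic dimension zero carries, up to a macro-uniform equivalence, the
  ultrametric that sends \<open>(x, y)\<close> to the least \<open>i\<close> with \<open>(x, y) \<in> E i\<close>. Distances are only
  seen up to re-indexing, so \<open>E 0\<close> need not be equality.\<close>

locale tower =
  fixes X :: "'a set" and E :: "nat \<Rightarrow> ('a \<times> 'a) set"
  assumes equiv_E: "equiv X (E i)"
    and E_Suc: "E i \<subseteq> E (Suc i)"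
    and E_exhaust: "x \<in> X \<Longrightarrow> y \<in> X \<Longrightarrow> \<exists>i. (x, y) \<in> E i"
begin

lemma E_mono: "i \<le> j \<Longrightarrow> E i \<subseteq> E j"
  using E_Suc by (rule lift_Suc_mono_le)

lemma E_monoD: "(x, y) \<in> E i \<Longrightarrow> i \<le> j \<Longrightarrow> (x, y) \<in> E j"
  using E_mono by blast

lemma E_in: "(x, y) \<in> E i \<Longrightarrow> x \<in> X \<and> y \<in> X"
  using equiv_E[of i] by (auto simp: equiv_def refl_on_def)

lemma E_refl: "x \<in> X \<Longrightarrow> (x, x) \<in> E i"
  using equiv_E[of i] by (auto simp: equiv_def refl_on_def)

lemma E_sym: "(x, y) \<in> E i \<Longrightarrow> (y, x) \<in> E i"
  using equiv_E[of i] by (meson equivE symE)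

lemma E_trans: "(x, y) \<in> E i \<Longrightarrow> (y, z) \<in> E i \<Longrightarrow> (x, z) \<in> E i"
  using equiv_E[of i] by (meson equivE transE)

lemma class_eq: "(x, y) \<in> E i \<Longrightarrow> E i `` {x} = E i `` {y}"
  using equiv_E by (rule equiv_class_eq)

lemma tower_subsequence:
  assumes "strict_mono r"
  shows "tower X (\<lambda>i. E (r i))"
proof
  show "equiv X (E (r i))" for i by (rule equiv_E)
  show "E (r i) \<subseteq> E (r (Suc i))" for i
    by (rule E_mono) (simp add: assms strict_mono_leD)
  fix x y assume "x \<in> X" "y \<in> X"
  then obtain i where "(x, y) \<in> E i" using E_exhaust by blast
  then show "\<exists>i. (x, y) \<in> E (r i)"
    using E_monoD strict_mono_imp_increasing[OF assms] by blast
qed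

lemma tower_restrict:
  assumes "R \<subseteq> X"
  shows "tower R (\<lambda>i. E i \<inter> R \<times> R)"
proof
  show "equiv R (E i \<inter> R \<times> R)" for i
    using assms E_refl E_sym E_trans
    by (intro equivI refl_onI symI transI) blast+
  show "E i \<inter> R \<times> R \<subseteq> E (Suc i) \<inter> R \<times> R" for i
    using E_Suc by blast
  show "\<exists>i. (x, y) \<in> E i \<inter> R \<times> R" if "x \<in> R" "y \<in> R" for x y
    using E_exhaust that assms by blast
qed

end

lemma last_diff_le_iff:
  assumes "x \<in> fin_seqs K" "y \<in> fin_seqs K"
  shows "last_diff x y \<le> real m \<longleftrightarrow> (\<forall>i>m. x i = y i)"
proof -
  have fin: "finite ({0} \<union> {i\<in>{1..}. x i \<noteq> y i})"
    using finite_diff_fin_seqs[OF assms] by simp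
  have "last_diff x y \<le> real m \<longleftrightarrow> (\<forall>i\<in>{0} \<union> {i\<in>{1..}. x i \<noteq> y i}. i \<le> m)"
    unfolding last_diff_def of_nat_le_iff using fin by (subst Max_le_iff) auto
  also have "\<dots> \<longleftrightarrow> (\<forall>i>m. x i = y i)"
  proof
    assume a: "\<forall>i\<in>{0} \<union> {i\<in>{1..}. x i \<noteq> y i}. i \<le> m"
    show "\<forall>i>m. x i = y i"
    proof (intro allI impI, rule ccontr)
      fix i assume i: "m < i" "x i \<noteq> y i"
      then have "i \<in> {0} \<union> {i\<in>{1..}. x i \<noteq> y i}" by simp
      then have "i \<le> m" using a by blast
      then show False using i by simp
    qed
  next
    assume a: "\<forall>i>m. x i = y i"
    show "\<forall>i\<in>{0} \<union> {i\<in>{1..}. x i \<noteq> y i}. i \<le> m"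
    proof
      fix i assume "i \<in> {0} \<union> {i\<in>{1..}. x i \<noteq> y i}"
      then have "i = 0 \<or> x i \<noteq> y i" by blast
      then show "i \<le> m" using a by (cases "m < i") auto
    qed
  qed
  finally show ?thesis .
qed

text \<open>The digit expansion of a point: \<open>l i\<close> names the class of level \<open>i\<close> inside the surrounding
  class of level \<open>i + 1\<close>, and the digit sequence determines the class of level \<open>m\<close> from its
  digits beyond \<open>m\<close>. The expansion of \<open>x\<close> ends in zeros because \<open>x\<close> is eventually in the same
  class as \<open>x0\<close>, all of whose digits are 0. The digits sit at positions \<open>i \<ge> 1\<close>, hence the
  shift by one.\<close>

lemma (in tower) coding:
  assumes x0: "x0 \<in> X"
    and lab: "\<And>i x y. (x, y) \<in> E i \<Longrightarrow> l i x = l i y"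
    and sep: "\<And>i x y. (x, y) \<in> E (Suc i) \<Longrightarrow> l i x = l i y \<Longrightarrow> (x, y) \<in> E i"
    and rng: "\<And>i x. x \<in> X \<Longrightarrow> l i x \<in> K"
    and onto: "\<And>i x k. x \<in> X \<Longrightarrow> k \<in> K \<Longrightarrow> \<exists>y. (x, y) \<in> E (Suc i) \<and> l i y = k"
    and base: "\<And>i. l i x0 = 0"
  shows "\<exists>f. f ` X = fin_seqs K \<and>
             (\<forall>x\<in>X. \<forall>y\<in>X. \<forall>m. last_diff (f x) (f y) \<le> real m \<longleftrightarrow> (x, y) \<in> E m)"
proof -
  define f where "f x = (\<lambda>i. if i \<ge> 1 then l (i - 1) x else undefined)" for x
  have stable: "l j x = l j y" if "(x, y) \<in> E i" "i \<le> j" for i j x y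
    using lab E_monoD that by blast
  have f_in: "f x \<in> fin_seqs K" if x: "x \<in> X" for x
  proof -
    obtain n where n: "(x, x0) \<in> E n" using E_exhaust x x0 by blast
    have "f x i = 0" if "i > Suc n" for i
      using that stable[OF n, of "i - 1"] base by (simp add: f_def)
    moreover have "f x \<in> {1..} \<rightarrow>\<^sub>E K"
      unfolding PiE_iff extensional_def using rng x by (simp add: f_def)
    ultimately show ?thesis
      unfolding fin_seqs_def by (intro CollectI conjI exI[of _ "Suc n"]) auto
  qed
  have diff: "last_diff (f x) (f y) \<le> real m \<longleftrightarrow> (x, y) \<in> E m" if xy: "x \<in> X" "y \<in> X" for x y m
  proof -
    have "last_diff (f x) (f y) \<le> real m \<longleftrightarrow> (\<forall>i>m. f x i = f y i)"
      using last_diff_le_iff f_in xy by blast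
    also have "\<dots> \<longleftrightarrow> (\<forall>j\<ge>m. l j x = l j y)"
    proof
      assume a: "\<forall>i>m. f x i = f y i"
      show "\<forall>j\<ge>m. l j x = l j y"
      proof (intro allI impI)
        fix j assume "m \<le> j"
        then have "f x (Suc j) = f y (Suc j)" using a by simp
        then show "l j x = l j y" by (simp add: f_def)
      qed
    qed (auto simp: f_def)
    also have "\<dots> \<longleftrightarrow> (x, y) \<in> E m"
    proof
      assume a: "\<forall>j\<ge>m. l j x = l j y"
      obtain N where N: "(x, y) \<in> E N" using E_exhaust xy by blast
      have "(x, y) \<in> E (m + k) \<Longrightarrow> (x, y) \<in> E m" for k
        by (induction k) (use a sep in auto)
      from this[of N] show "(x, y) \<in> E m" using E_monoD[OF N, of "m + N"] by simp
    qed (use stable in blast)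
    finally show ?thesis .
  qed
  \<comment> \<open>A finitely supported sequence is realised by starting at \<open>x0\<close> and correcting the digits
    from the highest one down; correcting a digit leaves all higher ones alone.\<close>
  have reach: "\<exists>x\<in>X. \<forall>i. l i x = z i"
    if z: "\<forall>i. z i \<in> K" "\<forall>i\<ge>n. z i = 0" for z n
  proof -
    have "\<exists>x\<in>X. \<forall>i\<ge>n - k. l i x = z i" for k
    proof (induction k)
      case 0
      then show ?case using x0 base z by auto
    next
      case (Suc k)
      then obtain x where x: "x \<in> X" "\<forall>i\<ge>n - k. l i x = z i" by blast
      show ?case
      proof (cases "k < n")
        case False
        then show ?thesis using x by auto
      next
        case True
        obtain y where y: "(x, y) \<in> E (Suc (n - Suc k))" "l (n - Suc k) y = z (n - Suc k)"
          using onto[OF x(1), of "z (n - Suc k)" "n - Suc k"] z(1) by blast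
        have "l i y = z i" if "i \<ge> n - Suc k" for i
        proof (cases "i = n - Suc k")
          case False
          then have "i \<ge> Suc (n - Suc k)" using that by simp
          then have "l i x = l i y" using stable y by blast
          moreover have "i \<ge> n - k" using \<open>i \<ge> Suc (n - Suc k)\<close> True by simp
          ultimately show ?thesis using x(2) by simp
        qed (use y in simp)
        then show ?thesis using E_in y(1) by blast
      qed
    qed
    from this[of n] show ?thesis by simp
  qed
  have "fin_seqs K \<subseteq> f ` X"
  proof
    fix y assume y: "y \<in> fin_seqs K"
    then have "\<exists>n. \<forall>i>n. y i = 0" unfolding fin_seqs_def by auto
    then obtain n where n: "\<forall>i>n. y i = 0" by blast
    have yK: "y \<in> {1..} \<rightarrow>\<^sub>E K" using y by (simp add: fin_seqs_def)
    obtain x where x: "x \<in> X" "\<And>i. l i x = y (Suc i)"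
      using reach[of "\<lambda>i. y (Suc i)" n] n yK by (auto simp: PiE_iff)
    have "f x = y"
      using yK by (auto simp: f_def x(2) fun_eq_iff PiE_iff extensional_def)
    then show "y \<in> f ` X" using x(1) by blast
  qed
  then show ?thesis using f_in diff by blast
qed

section \<open>Packing weighted items into equal blocks\<close>

text \<open>Adding the elements one at a time, the partial sums cannot jump over the window
  \<open>[t - M, t]\<close>.\<close>

lemma subset_sum_near:
  fixes s :: "'b \<Rightarrow> real"
  assumes "finite A" "0 \<le> M" "\<forall>a\<in>A. s a \<le> M" "0 \<le> t" "t \<le> sum s A"
  shows "\<exists>S\<subseteq>A. t - M \<le> sum s S \<and> sum s S \<le> t"
  using assms
proof (induction A rule: finite_induct)
  case empty
  then show ?case by auto
next
  case (insert a A)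
  show ?case
  proof (cases "t \<le> sum s A")
    case True
    then show ?thesis using insert by (meson insertCI subset_insertI2)
  next
    case False
    then show ?thesis using insert by (intro exI[of _ A]) auto
  qed
qed

text \<open>Groups of weight exactly \<open>V\<close> need not exist, and errors that only accumulate would
  ruin the last groups. So the induction carries the total with an error in \<open>[0, M]\<close>: the
  group that is split off absorbs the error of what was there before, and the remainder
  has again an error in \<open>[0, M]\<close>.\<close>

lemma balanced_groups:
  fixes s :: "'b \<Rightarrow> real"
  assumes "finite A" "0 \<le> M" "\<forall>a\<in>A. s a \<le> M" "0 \<le> V"
    and "real (Suc g) * V \<le> sum s A" "sum s A \<le> real (Suc g) * V + M"
  shows "\<exists>c. (\<forall>a\<in>A. c a \<le> g) \<and> (\<forall>k\<le>g. \<bar>sum s {a\<in>A. c a = k} - V\<bar> \<le> M)"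
  using assms
proof (induction g arbitrary: A)
  case 0
  then show ?case by (intro exI[of _ "\<lambda>_. 0"]) auto
next
  case (Suc g)
  define t where "t = sum s A - real (Suc g) * V"
  have t: "V \<le> t" "t \<le> V + M" "t \<le> sum s A"
    using Suc.prems by (auto simp: t_def algebra_simps)
  then obtain S where S: "S \<subseteq> A" "t - M \<le> sum s S" "sum s S \<le> t"
    using subset_sum_near[of A M s t] Suc.prems by auto
  have diff: "sum s (A - S) = sum s A - sum s S"
    using S Suc.prems by (simp add: sum_diff)
  obtain c where c: "\<forall>a\<in>A - S. c a \<le> g" "\<forall>k\<le>g. \<bar>sum s {a\<in>A - S. c a = k} - V\<bar> \<le> M"
    using Suc.IH[of "A - S"] Suc.prems S t diff unfolding t_def by fastforce
  define c' where "c' a = (if a \<in> S then Suc g else c a)" for a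
  have "\<bar>sum s {a\<in>A. c' a = k} - V\<bar> \<le> M" if "k \<le> Suc g" for k
  proof (cases "k = Suc g")
    case True
    have "c a \<noteq> Suc g" if "a \<in> A" "a \<notin> S" for a
      using c(1) that by (metis DiffI Suc_n_not_le_n)
    then have "{a\<in>A. c' a = k} = S" using S(1) True by (auto simp: c'_def)
    then show ?thesis using S t by auto
  next
    case False
    then have "{a\<in>A. c' a = k} = {a\<in>A - S. c a = k}" using S(1) by (auto simp: c'_def)
    then show ?thesis using c(2) that False by auto
  qed
  then show ?case using c(1) by (intro exI[of _ c']) (auto simp: c'_def le_SucI)
qed

text \<open>An integer intermediate value theorem for sums with independent summands.\<close>

lemma choose_summands:
  fixes lo hi :: "'b \<Rightarrow> nat"
  assumes "finite A" "\<forall>a\<in>A. lo a \<le> hi a" "sum lo A \<le> Q" "Q \<le> sum hi A"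
  shows "\<exists>v. (\<forall>a\<in>A. lo a \<le> v a \<and> v a \<le> hi a) \<and> sum v A = Q"
  using assms
proof (induction A arbitrary: Q rule: finite_induct)
  case empty
  then show ?case by auto
next
  case (insert a A)
  define q where "q = max (lo a) (Q - sum hi A)"
  have q: "lo a \<le> q" "q \<le> hi a" "q \<le> Q" "sum lo A \<le> Q - q" "Q - q \<le> sum hi A"
    using insert.prems insert.hyps sum_mono[of A lo hi] by (auto simp: q_def)
  then obtain v where v: "\<forall>a\<in>A. lo a \<le> v a \<and> v a \<le> hi a" "sum v A = Q - q"
    using insert.IH[of "Q - q"] insert.prems by auto
  have "sum (v(a := q)) A = sum v A"
    using insert.hyps by (intro sum.cong) auto
  then show ?case
    using v q insert.hyps by (intro exI[of _ "v(a := q)"]) auto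
qed

lemma arrange_intervals:
  fixes v :: "'b \<Rightarrow> nat"
  assumes "finite A"
  shows "\<exists>p. (d \<in> A \<longrightarrow> p d = 0) \<and> (\<forall>a\<in>A. p a + v a \<le> sum v A) \<and>
             (\<forall>t<sum v A. \<exists>!a. a \<in> A \<and> p a \<le> t \<and> t < p a + v a)"
  using assms
proof (induction A rule: finite_induct)
  case empty
  then show ?case by auto
next
  case (insert x A)
  then obtain p where p: "d \<in> A \<longrightarrow> p d = 0" "\<forall>a\<in>A. p a + v a \<le> sum v A"
    "\<forall>t<sum v A. \<exists>!a. a \<in> A \<and> p a \<le> t \<and> t < p a + v a" by blast
  define p' where "p' = (\<lambda>a. if x = d then (if a = x then 0 else v x + p a)
                             else (if a = x then sum v A else p a))"
  have s: "sum v (insert x A) = v x + sum v A" using insert by simp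
  have "\<exists>!a. a \<in> insert x A \<and> p' a \<le> t \<and> t < p' a + v a" if t: "t < v x + sum v A" for t
  proof (cases "x = d")
    case True
    show ?thesis
    proof (cases "t < v x")
      case True
      then show ?thesis using \<open>x = d\<close> insert.hyps
        by (intro ex1I[of _ x]) (auto simp: p'_def split: if_splits)
    next
      case False
      then have "t - v x < sum v A" using t by simp
      then have "\<exists>!a. a \<in> A \<and> p a \<le> t - v x \<and> t - v x < p a + v a" using p(3) by blast
      moreover have "(a \<in> insert x A \<and> p' a \<le> t \<and> t < p' a + v a)
          \<longleftrightarrow> (a \<in> A \<and> p a \<le> t - v x \<and> t - v x < p a + v a)" for a
        using \<open>x = d\<close> False insert.hyps by (auto simp: p'_def)
      ultimately show ?thesis by simp
    qed
  next
    case False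
    show ?thesis
    proof (cases "t < sum v A")
      case True
      then have "\<exists>!a. a \<in> A \<and> p a \<le> t \<and> t < p a + v a" using p(3) by blast
      moreover have "(a \<in> insert x A \<and> p' a \<le> t \<and> t < p' a + v a)
          \<longleftrightarrow> (a \<in> A \<and> p a \<le> t \<and> t < p a + v a)" for a
        using \<open>x \<noteq> d\<close> True insert.hyps by (auto simp: p'_def)
      ultimately show ?thesis by simp
    next
      case F: False
      show ?thesis
      proof (rule ex1I[of _ x])
        show "x \<in> insert x A \<and> p' x \<le> t \<and> t < p' x + v x"
          using F t False by (auto simp: p'_def)
        fix a assume a: "a \<in> insert x A \<and> p' a \<le> t \<and> t < p' a + v a"
        show "a = x"
        proof (rule ccontr)
          assume "a \<noteq> x"
          then have "a \<in> A" "t < p a + v a" using a False by (auto simp: p'_def)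
          then show False using p(2) F by fastforce
        qed
      qed
    qed
  qed
  moreover have "d \<in> insert x A \<longrightarrow> p' d = 0" using p(1) by (auto simp: p'_def)
  moreover have "\<forall>a\<in>insert x A. p' a + v a \<le> v x + sum v A"
    using p(2) insert.hyps by (auto simp: p'_def trans_le_add2)
  ultimately show ?case unfolding s by (intro exI[of _ p']) blast
qed

text \<open>The counting step behind the passage from one level to the next. Items \<open>a\<close> of weight \<open>s a\<close>
  are put into \<open>g\<close> blocks of \<open>Q\<close> consecutive cells, an item taking any number of cells
  between \<open>lo a\<close> and \<open>hi a\<close>. In units of length \<open>u\<close> per cell, its length can thus take all values from
  \<open>\<alpha> * s a\<close> to \<open>\<beta> * s a\<close> that are multiples of \<open>u\<close>. Groups of nearly equal
  weight \<open>V\<close> fill a block each: the margins \<open>M\<close> in the two bounds on \<open>Q * u\<close> pay for the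
  imbalance of the groups. One item \<open>d\<close> may be prescribed: it takes exactly \<open>v0\<close> cells and
  starts at cell 0, which costs one more margin. This is what lets a map on one class be
  extended to a larger class. In the conclusion, \<open>a\<close> occupies the cells from \<open>p a\<close> to
  \<open>p a + v a - 1\<close>, all in block number \<open>c a\<close>, and the cells are tiled.\<close>

lemma packing:
  fixes s :: "'b \<Rightarrow> real" and lo hi :: "'b \<Rightarrow> nat" and \<alpha> \<beta> u M V :: real and g Q v0 :: nat
  assumes fin: "finite A" and d: "d \<in> A" and g: "0 < g" and u: "0 < u"
    and \<alpha>: "0 \<le> \<alpha>" and \<beta>: "0 \<le> \<beta>"
    and s: "\<And>a. a \<in> A \<Longrightarrow> 0 \<le> s a \<and> s a \<le> M"
    and lohi: "\<And>a. a \<in> A \<Longrightarrow> lo a \<le> hi a"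
    and lo: "\<And>a. a \<in> A \<Longrightarrow> lo a * u \<le> \<alpha> * s a"
    and hi: "\<And>a. a \<in> A \<Longrightarrow> \<beta> * s a \<le> hi a * u"
    and v0: "lo d \<le> v0" "v0 \<le> hi d" "v0 * u \<le> M"
    and V: "sum s A = g * V"
    and Q: "\<alpha> * (V + M) + M \<le> Q * u" "Q * u \<le> \<beta> * (V - 2 * M)"
  shows "\<exists>v p c. v d = v0 \<and> p d = 0 \<and>
     (\<forall>a\<in>A. lo a \<le> v a \<and> v a \<le> hi a \<and> c a < g \<and> c a * Q \<le> p a \<and> p a + v a \<le> Suc (c a) * Q) \<and>
     (\<forall>t<g * Q. \<exists>!a. a \<in> A \<and> p a \<le> t \<and> t < p a + v a)"
proof -
  have M: "0 \<le> M" using s[OF d] by linarith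
  have V0: "0 \<le> V"
  proof -
    have "0 \<le> sum s A" using s by (simp add: sum_nonneg)
    then show ?thesis using V g by (simp add: zero_le_mult_iff)
  qed
  obtain g' where g': "g = Suc g'" using g by (cases g) auto
  obtain c1 where c1: "\<forall>a\<in>A. c1 a \<le> g'" "\<forall>k\<le>g'. \<bar>sum s {a\<in>A. c1 a = k} - V\<bar> \<le> M"
    using balanced_groups[of A M s V g'] fin M s V V0 g' by auto
  \<comment> \<open>Renumber the groups so that the group of \<open>d\<close> becomes block 0.\<close>
  define c where "c a = Transposition.transpose 0 (c1 d) (c1 a)" for a
  have c_lt: "c a < g" if "a \<in> A" for a
    using c1(1) d that g' by (auto simp: c_def Transposition.transpose_def less_Suc_eq_le)
  have cd: "c d = 0" by (simp add: c_def)
  define G where "G k = {a\<in>A. c a = k}" for k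
  have finG: "finite (G k)" for k using fin by (simp add: G_def)
  have G_sum: "\<bar>sum s (G k) - V\<bar> \<le> M" if "k < g" for k
  proof -
    have "G k = {a\<in>A. c1 a = Transposition.transpose 0 (c1 d) k}"
      by (auto simp: G_def c_def)
    moreover have "Transposition.transpose 0 (c1 d) k \<le> g'"
      using that c1(1) d g' by (auto simp: Transposition.transpose_def)
    ultimately show ?thesis using c1(2) by simp
  qed
  define lo' where "lo' = lo(d := v0)"
  define hi' where "hi' = hi(d := v0)"
  have ex_v: "\<exists>v. (\<forall>a\<in>G k. lo' a \<le> v a \<and> v a \<le> hi' a) \<and> sum v (G k) = Q" if k: "k < g" for k
  proof (rule choose_summands[OF finG])
    show "\<forall>a\<in>G k. lo' a \<le> hi' a"
      using lohi by (auto simp: lo'_def hi'_def G_def)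
    have "real (sum lo' (G k)) * u = (\<Sum>a\<in>G k. lo' a * u)"
      by (simp add: sum_distrib_right)
    also have "\<dots> \<le> (\<Sum>a\<in>G k. \<alpha> * s a + (if a = d then M else 0))"
      using lo v0 \<alpha> s d by (intro sum_mono) (auto simp: lo'_def G_def add_increasing)
    also have "\<dots> = \<alpha> * sum s (G k) + (if d \<in> G k then M else 0)"
      using finG by (simp add: sum.distrib sum_distrib_left)
    also have "\<dots> \<le> \<alpha> * (V + M) + M"
      using G_sum[OF k] M \<alpha> by (intro add_mono mult_left_mono) auto
    finally have "real (sum lo' (G k)) * u \<le> Q * u" using Q by linarith
    then have "real (sum lo' (G k)) \<le> real Q" using u by (simp only: mult_le_cancel_right_pos)
    then show "sum lo' (G k) \<le> Q" by (simp only: of_nat_le_iff)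
    have "Q * u \<le> \<beta> * (V - 2 * M)" by (rule Q)
    also have "\<dots> \<le> \<beta> * (sum s (G k) - M)"
      using G_sum[OF k] \<beta> by (intro mult_left_mono) auto
    also have "\<dots> \<le> \<beta> * (sum s (G k) - (if d \<in> G k then s d else 0))"
      using s[OF d] M \<beta> by (intro mult_left_mono) auto
    also have "\<dots> = (\<Sum>a\<in>G k. \<beta> * (s a - (if a = d then s a else 0)))"
      using finG by (simp add: sum_distrib_left[symmetric] sum_subtractf)
    also have "\<dots> \<le> (\<Sum>a\<in>G k. hi' a * u)"
      using hi u by (intro sum_mono) (auto simp: hi'_def G_def)
    also have "\<dots> = real (sum hi' (G k)) * u"
      by (simp add: sum_distrib_right)
    finally have "real Q \<le> real (sum hi' (G k))"
      using u by (simp only: mult_le_cancel_right_pos)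
    then show "Q \<le> sum hi' (G k)" by (simp only: of_nat_le_iff)
  qed
  then obtain w where w: "\<And>k. k < g \<Longrightarrow> (\<forall>a\<in>G k. lo' a \<le> w k a \<and> w k a \<le> hi' a) \<and> sum (w k) (G k) = Q"
    by metis
  define v where "v a = w (c a) a" for a
  have v: "lo' a \<le> v a \<and> v a \<le> hi' a" if "a \<in> A" for a
    using w[of "c a"] c_lt that by (auto simp: v_def G_def)
  have vQ: "sum v (G k) = Q" if "k < g" for k
  proof -
    have "sum v (G k) = sum (w k) (G k)"
      by (rule sum.cong) (auto simp: v_def G_def)
    then show ?thesis using w[OF that] by simp
  qed
  have "\<exists>o'. (d \<in> G k \<longrightarrow> o' d = 0) \<and> (\<forall>a\<in>G k. o' a + v a \<le> sum v (G k)) \<and>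
             (\<forall>t<sum v (G k). \<exists>!a. a \<in> G k \<and> o' a \<le> t \<and> t < o' a + v a)" for k
    by (rule arrange_intervals[OF finG])
  then obtain q where q: "\<And>k. (d \<in> G k \<longrightarrow> q k d = 0) \<and> (\<forall>a\<in>G k. q k a + v a \<le> sum v (G k)) \<and>
             (\<forall>t<sum v (G k). \<exists>!a. a \<in> G k \<and> q k a \<le> t \<and> t < q k a + v a)"
    by metis
  define p where "p a = c a * Q + q (c a) a" for a
  have within: "q (c a) a + v a \<le> Q" if "a \<in> A" for a
    using q[of "c a"] vQ[OF c_lt[OF that]] that by (auto simp: G_def)
  have uniq: "\<exists>!a. a \<in> A \<and> p a \<le> t \<and> t < p a + v a" if t: "t < g * Q" for t
  proof -
    define k r where "k = t div Q" and "r = t mod Q"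
    have Q0: "0 < Q" using t by (cases Q) auto
    have k: "k < g" using t by (simp add: k_def less_mult_imp_div_less)
    have r: "r < Q" using Q0 by (simp add: r_def)
    have t_eq: "t = k * Q + r" by (simp add: k_def r_def)
    have "\<exists>!a. a \<in> G k \<and> q k a \<le> r \<and> r < q k a + v a"
      using q[of k] vQ[OF k] r by simp
    moreover have "(a \<in> A \<and> p a \<le> t \<and> t < p a + v a) \<longleftrightarrow> (a \<in> G k \<and> q k a \<le> r \<and> r < q k a + v a)" for a
    proof
      assume a: "a \<in> A \<and> p a \<le> t \<and> t < p a + v a"
      then have "c a * Q \<le> t" "t < c a * Q + Q"
        using within[of a] by (auto simp: p_def)
      then have "c a = k" using Q0 by (simp add: k_def div_nat_eqI mult.commute)
      then show "a \<in> G k \<and> q k a \<le> r \<and> r < q k a + v a"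
        using a t_eq by (auto simp: G_def p_def)
    qed (auto simp: G_def p_def t_eq)
    ultimately show ?thesis by simp
  qed
  have "v d = v0" using v[OF d] by (simp add: lo'_def hi'_def)
  moreover have "p d = 0" using cd q[of 0] d by (simp add: p_def G_def)
  moreover have "lo a \<le> v a \<and> v a \<le> hi a" if "a \<in> A" for a
    using v[OF that] v0 by (auto simp: lo'_def hi'_def split: if_splits)
  moreover have "c a * Q \<le> p a \<and> p a + v a \<le> Suc (c a) * Q" if "a \<in> A" for a
    using within[OF that] by (simp add: p_def)
  ultimately show ?thesis using uniq c_lt by (intro exI[of _ v] exI[of _ p] exI[of _ c]) auto
qed

section \<open>Towers with finite classes and the dyadic blocks of the natural numbers\<close>

text \<open>The tolerance available at level \<open>i\<close>. A class of \<open>N\<close> points at level \<open>i\<close> will be stretched or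
  shrunk to any length within \<open>1/2 \<plusminus> 4 * slack i\<close> times \<open>N\<close>. As the slack halves, the window
  loses \<open>2 * slack i\<close> on each side in going up one level: half of this pays for rounding to whole
  blocks, half for the imbalance of groups. Yet the window is never empty. At level 0 it is
  contained in \<open>[0, 1]\<close>, so that there the map only has to collapse points.\<close>

definition slack :: "nat \<Rightarrow> real" where
  "slack i = (1/2) ^ i / 16"

lemma slack_pos: "0 < slack i" and slack_le: "slack i \<le> 1/16"
  and slack_Suc: "slack (Suc i) = slack i / 2"
  by (auto simp: slack_def power_le_one)

text \<open>Class sizes and block lengths interleave: a block of length \<open>U i\<close> is negligible against a
  class of level \<open>i\<close>, which is negligible against a block of length \<open>U (i + 1)\<close>.\<close>

locale scaled_tower = tower +
  fixes U :: "nat \<Rightarrow> nat"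
  assumes finite_class: "x \<in> X \<Longrightarrow> finite (E i `` {x})"
    and U_0: "U 0 = 1"
    and U_pos: "0 < U i"
    and U_dvd: "U i dvd U (Suc i)"
    and U_le: "x \<in> X \<Longrightarrow> U i \<le> slack i * card (E i `` {x})"
    and U_ge: "x \<in> X \<Longrightarrow> 2 * card (E i `` {x}) \<le> slack i * U (Suc i)"
begin

text \<open>\<open>h\<close> spreads the class \<open>C\<close> of level \<open>i\<close> over the first \<open>g\<close> blocks of length \<open>U i\<close>, matching the
  levels below \<open>i\<close> up to one step: a class of level \<open>j\<close> stays within one block of length
  \<open>U (j + 1)\<close>, and such a block comes from a single class of level \<open>j + 1\<close>.\<close>

definition fills :: "nat \<Rightarrow> 'a set \<Rightarrow> nat \<Rightarrow> ('a \<Rightarrow> nat) \<Rightarrow> bool" where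
  "fills i C g h \<longleftrightarrow> h ` C = {..<g * U i} \<and>
     (\<forall>x\<in>C. \<forall>y\<in>C. \<forall>j<i.
        ((x, y) \<in> E j \<longrightarrow> h x div U (Suc j) = h y div U (Suc j)) \<and>
        (h x div U (Suc j) = h y div U (Suc j) \<longrightarrow> (x, y) \<in> E (Suc j)))"

definition feasible :: "nat \<Rightarrow> 'a set \<Rightarrow> nat \<Rightarrow> bool" where
  "feasible i C g \<longleftrightarrow> (1/2 - 4 * slack i) * card C \<le> g * U i \<and>
                     g * U i \<le> (1/2 + 4 * slack i) * card C"

lemma U_dvd_le: "i \<le> j \<Longrightarrow> U i dvd U j"
proof (induction rule: dec_induct)
  case (step n)
  show ?case by (rule dvd_trans[OF step.IH U_dvd])
qed simp

lemma card_class_pos: "x \<in> X \<Longrightarrow> 0 < card (E i `` {x})"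
  unfolding card_gt_0_iff using finite_class E_refl by blast

text \<open>Given a packing of the subclasses \<open>a\<close> of \<open>C\<close>, the maps \<open>H a\<close> are translated to the positions
  \<open>p a\<close>. Translations by multiples of \<open>U i\<close> preserve all smaller blocks, so only level \<open>i\<close> needs
  care: there it matters that each subclass lies in a single block of length \<open>U (i + 1)\<close>.\<close>

lemma fills_glue:
  assumes C: "C = E (Suc i) `` {z}"
    and H: "\<And>x. x \<in> C \<Longrightarrow> fills i (E i `` {x}) (v (E i `` {x})) (H (E i `` {x}))"
    and Q: "U (Suc i) = Q * U i"
    and blk: "\<And>a. a \<in> C // E i \<Longrightarrow> c a < g \<and> c a * Q \<le> p a \<and> p a + v a \<le> Suc (c a) * Q"
    and tile: "\<And>t. t < g * Q \<Longrightarrow> \<exists>!a. a \<in> C // E i \<and> p a \<le> t \<and> t < p a + v a"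
  shows "fills (Suc i) C g (\<lambda>x. p (E i `` {x}) * U i + H (E i `` {x}) x)"
proof -
  define K where "K x = E i `` {x}" for x
  define h where "h x = p (K x) * U i + H (K x) x" for x
  have CX: "x \<in> X" if "x \<in> C" for x using that E_in C by blast
  have in_K: "x \<in> K x" if "x \<in> C" for x using E_refl CX that by (auto simp: K_def)
  have K_q: "K x \<in> C // E i" if "x \<in> C" for x using that by (auto simp: K_def intro: quotientI)
  have K_eq: "K x = K y \<longleftrightarrow> (x, y) \<in> E i" if "x \<in> C" "y \<in> C" for x y
  proof
    assume "K x = K y"
    then have "y \<in> K x" using in_K[OF that(2)] by simp
    then show "(x, y) \<in> E i" by (simp add: K_def)
  qed (simp add: K_def class_eq)
  have HK: "fills i (K x) (v (K x)) (H (K x))" if "x \<in> C" for x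
    using H[OF that] by (simp add: K_def)
  have H_lt: "H (K x) x < v (K x) * U i" if "x \<in> C" for x
    using HK[OF that] in_K[OF that] unfolding fills_def by blast
  have h_div: "h x div U i = p (K x) + H (K x) x div U i" for x
    using U_pos by (simp add: h_def)
  have h_div_lt: "p (K x) \<le> h x div U i \<and> h x div U i < p (K x) + v (K x)" if "x \<in> C" for x
    using H_lt[OF that] by (simp add: h_div less_mult_imp_div_less)
  have Q0: "0 < Q" using U_pos[of "Suc i"] Q by (cases Q) auto
  have h_top: "h x div U (Suc i) = c (K x)" if "x \<in> C" for x
  proof -
    have "h x div U (Suc i) = (h x div U i) div Q"
      unfolding Q mult.commute[of Q] by (rule div_mult2_eq)
    also have "\<dots> = c (K x)"
      using h_div_lt[OF that] blk[OF K_q[OF that]] by (intro div_nat_eqI) (auto simp: algebra_simps)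
    finally show ?thesis .
  qed
  have same_block: "K x = K y" if xy: "x \<in> C" "y \<in> C" and eq: "h x div U i = h y div U i" for x y
  proof -
    have "h x div U i < Suc (c (K x)) * Q"
      using h_div_lt[OF xy(1)] blk[OF K_q[OF xy(1)]] by linarith
    also have "\<dots> \<le> g * Q"
      using blk[OF K_q[OF xy(1)]] by (intro mult_right_mono) auto
    finally show ?thesis
      using tile[of "h x div U i"] h_div_lt[OF xy(1)] h_div_lt[OF xy(2)] K_q xy eq by metis
  qed
  have shift: "h x div U (Suc j) = p (K x) * (U i div U (Suc j)) + H (K x) x div U (Suc j)" if "j < i" for x j
  proof -
    obtain k where "U i = U (Suc j) * k" using U_dvd_le[of "Suc j" i] \<open>j < i\<close> by (auto elim: dvdE)
    then show ?thesis using U_pos[of "Suc j"]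
      by (simp add: h_def mult.left_commute[of _ "U (Suc j)"])
  qed
  have low: "((x, y) \<in> E j \<longrightarrow> h x div U (Suc j) = h y div U (Suc j)) \<and>
        (h x div U (Suc j) = h y div U (Suc j) \<longrightarrow> (x, y) \<in> E (Suc j))"
    if xy: "x \<in> C" "y \<in> C" and j: "j < i" for x y j
  proof -
    have *: "((x, y) \<in> E j \<longrightarrow> h x div U (Suc j) = h y div U (Suc j)) \<and>
        (h x div U (Suc j) = h y div U (Suc j) \<longrightarrow> (x, y) \<in> E (Suc j))" if "K x = K y"
    proof -
      have "y \<in> K x" using that in_K xy by simp
      then have "((x, y) \<in> E j \<longrightarrow> H (K x) x div U (Suc j) = H (K x) y div U (Suc j)) \<and>
        (H (K x) x div U (Suc j) = H (K x) y div U (Suc j) \<longrightarrow> (x, y) \<in> E (Suc j))"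
        using HK[OF xy(1)] in_K[OF xy(1)] j unfolding fills_def by blast
      then show ?thesis using that by (simp add: shift[OF j])
    qed
    moreover have "K x = K y" if "(x, y) \<in> E j"
      using E_monoD[OF that, of i] j K_eq xy by simp
    moreover have "K x = K y" if eq: "h x div U (Suc j) = h y div U (Suc j)"
    proof (rule same_block[OF xy])
      obtain k where k: "U i = U (Suc j) * k" using U_dvd_le[of "Suc j" i] \<open>j < i\<close> by (auto elim: dvdE)
      show "h x div U i = h y div U i"
        unfolding k by (simp add: div_mult2_eq eq)
    qed
    ultimately show ?thesis by blast
  qed
  have top: "((x, y) \<in> E i \<longrightarrow> h x div U (Suc i) = h y div U (Suc i)) \<and> (x, y) \<in> E (Suc i)"
    if xy: "x \<in> C" "y \<in> C" for x y
  proof -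
    have "(x, y) \<in> E (Suc i)" using xy E_sym E_trans unfolding C by blast
    then show ?thesis using K_eq[OF xy] h_top xy by auto
  qed
  have levels: "((x, y) \<in> E j \<longrightarrow> h x div U (Suc j) = h y div U (Suc j)) \<and>
        (h x div U (Suc j) = h y div U (Suc j) \<longrightarrow> (x, y) \<in> E (Suc j))"
    if xy: "x \<in> C" "y \<in> C" and j: "j < Suc i" for x y j
  proof (cases "j = i")
    case True
    then show ?thesis using top[OF xy] by blast
  next
    case False
    then show ?thesis using low[OF xy] j by simp
  qed
  have image: "h ` C = {..<g * U (Suc i)}"
  proof (intro equalityI subsetI)
    fix t assume "t \<in> h ` C"
    then obtain x where x: "x \<in> C" "t = h x" by blast
    have "t div U (Suc i) < g" using h_top[OF x(1)] blk[OF K_q[OF x(1)]] x(2) by simp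
    then show "t \<in> {..<g * U (Suc i)}"
      using U_pos by (simp add: div_less_iff_less_mult)
  next
    fix t assume "t \<in> {..<g * U (Suc i)}"
    then have "t < (g * Q) * U i" by (simp add: Q mult.assoc)
    then have "t div U i < g * Q" by (simp add: less_mult_imp_div_less)
    then obtain a where a: "a \<in> C // E i" "p a \<le> t div U i" "t div U i < p a + v a"
      using tile by blast
    then obtain x where x: "x \<in> C" "a = K x" by (auto simp: K_def elim: quotientE)
    have "p a * U i \<le> t" "t < (p a + v a) * U i"
      using a U_pos[of i] by (simp_all add: less_eq_div_iff_mult_less_eq div_less_iff_less_mult)
    then have "t - p a * U i \<in> H a ` a"
      using HK[OF x(1)] x(2) by (auto simp: fills_def algebra_simps)
    then obtain y where y: "y \<in> a" "H a y = t - p a * U i" by auto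
    have "(x, y) \<in> E i" using y x by (simp add: K_def)
    then have yC: "y \<in> C" using x(1) E_Suc E_trans unfolding C by blast
    then have "K y = a" using K_eq[OF x(1) yC] \<open>(x, y) \<in> E i\<close> x(2) by simp
    then have "h y = t" using y \<open>p a * U i \<le> t\<close> by (simp add: h_def)
    then show "t \<in> h ` C" using yC by blast
  qed
  have "fills (Suc i) C g h"
    unfolding fills_def using levels by (intro conjI image ballI allI impI) blast+
  then show ?thesis unfolding h_def K_def .
qed

text \<open>Feasible block numbers form an integer interval. Rounding its ends moves them by less than
  one block, that is, by at most \<open>slack i\<close> times the size of the class.\<close>

lemma feasible_interval:
  fixes i x
  assumes x: "x \<in> X"
  defines "s \<equiv> real (card (E i `` {x}))"
  shows "\<exists>lo hi. lo \<le> hi \<and> (\<forall>g. lo \<le> g \<longrightarrow> g \<le> hi \<longrightarrow> feasible i (E i `` {x}) g) \<and>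
     (\<forall>g. feasible i (E i `` {x}) g \<longrightarrow> lo \<le> g \<and> g \<le> hi) \<and>
     lo * U i \<le> (1/2 - 3 * slack i) * s \<and> (1/2 + 3 * slack i) * s \<le> hi * U i"
proof -
  define u where "u = real (U i)"
  have u: "0 < u" using U_pos by (simp add: u_def)
  have us: "u \<le> slack i * s" using U_le[OF x] by (simp add: u_def s_def)
  have s0: "0 \<le> s" by (simp add: s_def)
  define a b where "a = (1/2 - 4 * slack i) * s" and "b = (1/2 + 4 * slack i) * s"
  have a0: "0 \<le> a" using slack_le[of i] s0 by (simp add: a_def)
  have b0: "0 \<le> b" using slack_pos[of i] s0 by (simp add: b_def)
  define lo hi where "lo = nat \<lceil>a / u\<rceil>" and "hi = nat \<lfloor>b / u\<rfloor>"
  have lo_le: "lo \<le> g \<longleftrightarrow> a \<le> g * u" for g :: nat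
    using u by (simp add: lo_def nat_le_iff ceiling_le_iff pos_divide_le_eq)
  have le_hi: "g \<le> hi \<longleftrightarrow> g * u \<le> b" for g :: nat
    using u b0 by (simp add: hi_def le_nat_iff le_floor_iff pos_le_divide_eq)
  have feas: "feasible i (E i `` {x}) g \<longleftrightarrow> lo \<le> g \<and> g \<le> hi" for g
    unfolding lo_le le_hi by (simp add: feasible_def a_def b_def s_def u_def)
  have "real lo * u \<le> a + u"
  proof -
    have "0 \<le> a / u" using a0 u by simp
    then have "real lo \<le> a / u + 1" unfolding lo_def by linarith
    then have "real lo * u \<le> (a / u + 1) * u" using u by (intro mult_right_mono) auto
    then show ?thesis using u by (simp add: distrib_right)
  qed
  also have "a + u \<le> (1/2 - 3 * slack i) * s"
    using us by (simp add: a_def algebra_simps)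
  finally have lo_bd: "real lo * u \<le> (1/2 - 3 * slack i) * s" .
  have "(1/2 + 3 * slack i) * s \<le> b - u"
    using us by (simp add: b_def algebra_simps)
  also have "b - u \<le> real hi * u"
  proof -
    have "0 \<le> b / u" using b0 u by simp
    then have "b / u - 1 \<le> real hi" unfolding hi_def by linarith
    then have "(b / u - 1) * u \<le> real hi * u" using u by (intro mult_right_mono) auto
    then show ?thesis using u by (simp add: left_diff_distrib)
  qed
  finally have hi_bd: "(1/2 + 3 * slack i) * s \<le> real hi * u" .
  have "(1/2 - 3 * slack i) * s \<le> (1/2 + 3 * slack i) * s"
    using slack_pos[of i] s0 by (intro mult_right_mono) auto
  then have "real lo * u \<le> real hi * u" using lo_bd hi_bd by linarith
  then have "real lo \<le> real hi" using u by (simp only: mult_le_cancel_right_pos)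
  then have "lo \<le> hi" by (simp only: of_nat_le_iff)
  then show ?thesis
    using feas lo_bd hi_bd unfolding u_def by (intro exI[of _ lo] exI[of _ hi]) simp
qed

lemma feasible_pos:
  assumes "feasible i (E i `` {x}) g" "x \<in> X"
  shows "0 < g"
proof (rule ccontr)
  assume "\<not> 0 < g"
  then have "(1/2 - 4 * slack i) * card (E i `` {x}) \<le> 0"
    using assms by (simp add: feasible_def)
  moreover have "0 < (1/2 - 4 * slack i) * card (E i `` {x})"
    using slack_le[of i] card_class_pos[OF assms(2)] by (intro mult_pos_pos) auto
  ultimately show False by linarith
qed

text \<open>The inductive step in the form that also serves the limit: a map on the class of \<open>x0\<close> at level
  \<open>i\<close> extends to its class at level \<open>i + 1\<close>, for every feasible number of blocks.\<close>

lemma fills_extend: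
  assumes x0: "x0 \<in> X" and g: "feasible (Suc i) (E (Suc i) `` {x0}) g"
    and g0: "feasible i (E i `` {x0}) g0" and h0: "fills i (E i `` {x0}) g0 h0"
    and ex: "\<And>x g. x \<in> X \<Longrightarrow> feasible i (E i `` {x}) g \<Longrightarrow> \<exists>h. fills i (E i `` {x}) g h"
  shows "\<exists>h. fills (Suc i) (E (Suc i) `` {x0}) g h \<and> (\<forall>x\<in>E i `` {x0}. h x = h0 x)"
proof -
  define C where "C = E (Suc i) `` {x0}"
  define A where "A = C // E i"
  define d where "d = E i `` {x0}"
  define T where "T = real (U (Suc i))"
  define M where "M = slack i * T / 2"
  define V where "V = card C / g"
  obtain Q where "U (Suc i) = U i * Q" using U_dvd[of i] by (rule dvdE)
  then have Q: "U (Suc i) = Q * U i" by (simp only: mult.commute)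
  have CX: "C \<subseteq> X" unfolding C_def using E_in by blast
  have finC: "finite C" using finite_class[OF x0] by (simp add: C_def)
  have A_class: "\<exists>x\<in>X. a = E i `` {x}" if "a \<in> A" for a
    using that CX by (auto simp: A_def quotient_def)
  have x0C: "x0 \<in> C" using x0 E_refl by (simp add: C_def)
  have dA: "d \<in> A" using x0C by (auto simp: A_def d_def intro: quotientI)
  have sub_class: "E i `` {x} \<subseteq> C" if "x \<in> C" for x
  proof
    fix y assume "y \<in> E i `` {x}"
    then have "(x, y) \<in> E (Suc i)" using E_Suc by blast
    moreover have "(x0, x) \<in> E (Suc i)" using that by (simp add: C_def)
    ultimately show "y \<in> C" using E_trans[of x0 x "Suc i" y] by (simp add: C_def)
  qed
  have A_sub: "A \<subseteq> X // E i" using CX by (auto simp: A_def quotient_def)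
  have UA: "\<Union>A = C"
  proof
    show "\<Union>A \<subseteq> C" unfolding A_def quotient_def using sub_class by blast
    show "C \<subseteq> \<Union>A"
    proof
      fix x assume x: "x \<in> C"
      then have "x \<in> E i `` {x}" using E_refl CX by blast
      moreover have "E i `` {x} \<in> A" using x by (simp add: A_def quotientI)
      ultimately show "x \<in> \<Union>A" by blast
    qed
  qed
  have finA: "finite A" using finC UA by (metis finite_UnionD)
  have disj: "pairwise disjnt A"
    unfolding pairwise_def disjnt_def using quotient_disj[OF equiv_E[of i]] A_sub by blast
  have card_C: "real (card C) = (\<Sum>a\<in>A. real (card a))"
  proof -
    have "card C = (\<Sum>a\<in>A. card a)"
      unfolding UA[symmetric]
    proof (rule card_Union_disjoint[OF disj])
      show "finite a" if "a \<in> A" for a using that UA finC by (metis Union_upper finite_subset)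
    qed
    then show ?thesis by simp
  qed
  have T0: "0 < T" using U_pos by (simp add: T_def)
  have M2: "2 * M = slack i * T" by (simp add: M_def)
  have M0: "0 \<le> M" using T0 slack_pos[of i] by (simp add: M_def)
  have g_pos: "0 < g" using feasible_pos[OF g x0] .
  have size: "real (card a) \<le> M" if "a \<in> A" for a
  proof -
    have "\<exists>x\<in>X. a = E i `` {x}" by (rule A_class[OF that])
    then obtain x where "x \<in> X" "a = E i `` {x}" by blast
    then show ?thesis using U_ge[of x i] by (simp add: M_def T_def)
  qed
  have V: "card C = g * V" using g_pos by (simp add: V_def)
  have VT: "(1/2 - 2 * slack i) * V \<le> T" "T \<le> (1/2 + 2 * slack i) * V"
  proof -
    have e: "4 * slack (Suc i) = 2 * slack i" by (simp add: slack_Suc)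
    have "(1/2 - 4 * slack (Suc i)) * card C \<le> g * T" "g * T \<le> (1/2 + 4 * slack (Suc i)) * card C"
      using g unfolding feasible_def C_def[symmetric] T_def of_nat_mult by simp_all
    then have "(1/2 - 2 * slack i) * (g * V) \<le> g * T" "g * T \<le> (1/2 + 2 * slack i) * (g * V)"
      unfolding e V .
    then have "g * ((1/2 - 2 * slack i) * V) \<le> g * T" "g * T \<le> g * ((1/2 + 2 * slack i) * V)"
      by (simp_all only: mult.left_commute)
    then show "(1/2 - 2 * slack i) * V \<le> T" "T \<le> (1/2 + 2 * slack i) * V"
      using g_pos by (simp_all only: mult_le_cancel_left_pos of_nat_0_less_iff)
  qed
  have V0: "0 \<le> V" by (simp add: V_def)
  have TV: "T \<le> V"
  proof -
    have "(1/2 + 2 * slack i) * V \<le> 1 * V"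
      using slack_le[of i] V0 by (intro mult_right_mono) auto
    then show ?thesis using VT by linarith
  qed
  have slTV: "slack i * T \<le> slack i * V"
    using TV slack_pos[of i] by (intro mult_left_mono) auto
  have "\<forall>a\<in>A. \<exists>lo hi. lo \<le> hi \<and> (\<forall>g. lo \<le> g \<longrightarrow> g \<le> hi \<longrightarrow> feasible i a g) \<and>
     (\<forall>g. feasible i a g \<longrightarrow> lo \<le> g \<and> g \<le> hi) \<and>
     lo * U i \<le> (1/2 - 3 * slack i) * real (card a) \<and> (1/2 + 3 * slack i) * real (card a) \<le> hi * U i"
    using feasible_interval A_class by blast
  then obtain lo hi where lohi: "\<And>a. a \<in> A \<Longrightarrow> lo a \<le> hi a \<and> (\<forall>g. lo a \<le> g \<longrightarrow> g \<le> hi a \<longrightarrow> feasible i a g) \<and>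
     (\<forall>g. feasible i a g \<longrightarrow> lo a \<le> g \<and> g \<le> hi a) \<and>
     lo a * U i \<le> (1/2 - 3 * slack i) * real (card a) \<and> (1/2 + 3 * slack i) * real (card a) \<le> hi a * U i"
    by metis
  have "\<exists>v p c. v d = g0 \<and> p d = 0 \<and>
     (\<forall>a\<in>A. lo a \<le> v a \<and> v a \<le> hi a \<and> c a < g \<and> c a * Q \<le> p a \<and> p a + v a \<le> Suc (c a) * Q) \<and>
     (\<forall>t<g * Q. \<exists>!a. a \<in> A \<and> p a \<le> t \<and> t < p a + v a)"
  \<comment> \<open>A subclass has at most \<open>M = slack i * T / 2\<close> points, so the margins \<open>2 * M\<close> amount to
      \<open>slack i * T\<close>, at most \<open>slack i\<close> times the average group size \<open>V\<close>.\<close>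
  proof (rule packing[where s = "\<lambda>a. real (card a)" and u = "real (U i)" and M = M and V = V
        and \<alpha> = "1/2 - 3 * slack i" and \<beta> = "1/2 + 3 * slack i"])
    show "finite A" "d \<in> A" "0 < g" "0 < real (U i)" using finA dA g_pos U_pos by auto
    show "0 \<le> 1/2 - 3 * slack i" "0 \<le> 1/2 + 3 * slack i"
      using slack_le[of i] slack_pos[of i] by auto
    show "lo d \<le> g0" "g0 \<le> hi d" using lohi[OF dA] g0 by (auto simp: d_def)
    have "real g0 * U i \<le> (1/2 + 4 * slack i) * card d" using g0 by (simp add: feasible_def d_def)
    also have "\<dots> \<le> 1 * real (card d)" using slack_le[of i] by (intro mult_right_mono) auto
    finally show "real g0 * U i \<le> M" using size[OF dA] by simp
    show "(\<Sum>a\<in>A. real (card a)) = real g * V" using card_C V by simp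
    have QT: "real Q * real (U i) = T" by (simp add: T_def Q)
    have "(1/2 - 3 * slack i) * M \<le> 1 * M" "(1/2 + 3 * slack i) * M \<le> 1 * M"
      using slack_pos[of i] slack_le[of i] M0 by (intro mult_right_mono; simp)+
    moreover have "(1/2 - 3 * slack i) * (V + M)
        = (1/2 - 2 * slack i) * V - slack i * V + (1/2 - 3 * slack i) * M"
      "(1/2 + 3 * slack i) * (V - 2 * M)
        = (1/2 + 2 * slack i) * V + slack i * V - 2 * ((1/2 + 3 * slack i) * M)"
      by (simp_all add: field_simps)
    ultimately show "(1/2 - 3 * slack i) * (V + M) + M \<le> real Q * real (U i)"
      "real Q * real (U i) \<le> (1/2 + 3 * slack i) * (V - 2 * M)"
      unfolding QT using VT slTV M2 by linarith+
  qed (use lohi size in auto)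
  then obtain v p c where v: "v d = g0" "p d = 0"
    "\<And>a. a \<in> A \<Longrightarrow> lo a \<le> v a \<and> v a \<le> hi a \<and> c a < g \<and> c a * Q \<le> p a \<and> p a + v a \<le> Suc (c a) * Q"
    "\<And>t. t < g * Q \<Longrightarrow> \<exists>!a. a \<in> A \<and> p a \<le> t \<and> t < p a + v a" by metis
  have "\<exists>h. fills i a (v a) h \<and> (a = d \<longrightarrow> h = h0)" if a: "a \<in> A" for a
  proof (cases "a = d")
    case True
    then show ?thesis using h0 v(1) by (auto simp: d_def)
  next
    case False
    have "feasible i a (v a)" using lohi v(3) a by blast
    then show ?thesis using ex A_class[OF a] False by blast
  qed
  then obtain H where H: "\<And>a. a \<in> A \<Longrightarrow> fills i a (v a) (H a) \<and> (a = d \<longrightarrow> H a = h0)" by metis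
  have "fills (Suc i) C g (\<lambda>x. p (E i `` {x}) * U i + H (E i `` {x}) x)"
  proof (rule fills_glue[OF C_def _ Q])
    show "fills i (E i `` {x}) (v (E i `` {x})) (H (E i `` {x}))" if "x \<in> C" for x
      using H that by (simp add: A_def quotientI)
  qed (use v A_def in auto)
  moreover have "p (E i `` {x}) * U i + H (E i `` {x}) x = h0 x" if "x \<in> E i `` {x0}" for x
  proof -
    have "E i `` {x} = d" using that class_eq by (auto simp: d_def)
    then show ?thesis using v(2) H[OF dA] by simp
  qed
  ultimately show ?thesis unfolding C_def by blast
qed

lemma feasible_exists: "x \<in> X \<Longrightarrow> \<exists>g. feasible i (E i `` {x}) g"
  using feasible_interval by blast

text \<open>At level 0 no structure below has to be respected, so any surjection onto at most as many
  cells as there are points will do.\<close>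

lemma fills_exists:
  assumes "x \<in> X" "feasible i (E i `` {x}) g"
  shows "\<exists>h. fills i (E i `` {x}) g h"
  using assms
proof (induction i arbitrary: x g)
  case 0
  define C where "C = E 0 `` {x}"
  have g: "0 < g" using feasible_pos 0 by blast
  have "real g \<le> (1/2 + 4 * slack 0) * card C" using 0 by (simp add: feasible_def C_def U_0)
  also have "\<dots> \<le> 1 * real (card C)" using slack_le[of 0] by (intro mult_right_mono) auto
  finally have gC: "g \<le> card C" by simp
  obtain e where e: "bij_betw e C {0..<card C}"
    using ex_bij_betw_finite_nat finite_class 0 C_def by blast
  have "(\<lambda>x. e x mod g) ` C = {..<g}"
  proof (intro equalityI subsetI)
    fix t assume "t \<in> {..<g}"
    then have "t \<in> e ` C" "t mod g = t" using e gC by (auto simp: bij_betw_def)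
    then show "t \<in> (\<lambda>x. e x mod g) ` C" by force
  qed (use g in auto)
  then show ?case unfolding fills_def C_def[symmetric] by (intro exI[of _ "\<lambda>x. e x mod g"]) (simp add: U_0)
next
  case (Suc i)
  obtain g0 where g0: "feasible i (E i `` {x}) g0" using feasible_exists Suc.prems by blast
  then obtain h0 where "fills i (E i `` {x}) g0 h0" using Suc by blast
  then show ?case using fills_extend[OF Suc.prems g0] Suc.IH by blast
qed

text \<open>The union of compatible maps on the increasing classes of \<open>x0\<close>, each spread over an initial
  segment of the natural numbers.\<close>

theorem dyadic_coding:
  assumes x0: "x0 \<in> X"
  shows "\<exists>h. h ` X = UNIV \<and> (\<forall>i. \<forall>x\<in>X. \<forall>y\<in>X.
     ((x, y) \<in> E i \<longrightarrow> h x div U (Suc i) = h y div U (Suc i)) \<and>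
     (h x div U (Suc i) = h y div U (Suc i) \<longrightarrow> (x, y) \<in> E (Suc i)))"
proof -
  define C where "C i = E i `` {x0}" for i
  have "\<exists>F. \<forall>n. (feasible n (C n) (fst (F n)) \<and> fills n (C n) (fst (F n)) (snd (F n))) \<and>
              (\<forall>x\<in>C n. snd (F (Suc n)) x = snd (F n) x)"
  proof (rule dependent_nat_choice)
    show "\<exists>F. feasible 0 (C 0) (fst F) \<and> fills 0 (C 0) (fst F) (snd F)"
      using feasible_exists[OF x0, of 0] fills_exists[OF x0] by (auto simp: C_def)
    fix F n assume F: "feasible n (C n) (fst F) \<and> fills n (C n) (fst F) (snd F)"
    obtain g where g: "feasible (Suc n) (C (Suc n)) g" 
      using feasible_exists[OF x0, of "Suc n"] unfolding C_def by blast
    obtain h where "fills (Suc n) (C (Suc n)) g h" "\<forall>x\<in>C n. h x = snd F x"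
      using fills_extend[OF x0, of n g "fst F" "snd F"] F g fills_exists unfolding C_def by blast
    then show "\<exists>F'. (feasible (Suc n) (C (Suc n)) (fst F') \<and> fills (Suc n) (C (Suc n)) (fst F') (snd F')) \<and>
              (\<forall>x\<in>C n. snd F' x = snd F x)"
      using g by (intro exI[of _ "(g, h)"]) auto
  qed
  then obtain F where F: "\<And>n. feasible n (C n) (fst (F n))" "\<And>n. fills n (C n) (fst (F n)) (snd (F n))"
    "\<And>n x. x \<in> C n \<Longrightarrow> snd (F (Suc n)) x = snd (F n) x" by metis
  have C_mono: "x \<in> C m" if "x \<in> C n" "n \<le> m" for x n m
    using that E_monoD by (auto simp: C_def)
  have stable: "snd (F m) x = snd (F n) x" if "n \<le> m" "x \<in> C n" for m n x
    using that by (induction rule: dec_induct) (use F(3) C_mono in auto)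
  define h where "h x = snd (F (LEAST n. x \<in> C n)) x" for x
  have h: "h x = snd (F n) x" if "x \<in> C n" for x n
    unfolding h_def using stable[of "LEAST n. x \<in> C n" n x] that
    by (metis LeastI Least_le)
  have C_X: "\<exists>n. x \<in> C n" if "x \<in> X" for x
    using E_exhaust[OF x0 that] by (auto simp: C_def)
  have CX: "C n \<subseteq> X" for n using E_in by (auto simp: C_def)
  have U_grows: "n < U (Suc n)" for n
  proof -
    have "2 * real 1 \<le> 2 * card (C n)" using card_class_pos[OF x0] by (simp add: C_def Suc_le_eq)
    also have "\<dots> \<le> slack n * U (Suc n)" using U_ge[OF x0] by (simp add: C_def)
    finally have "2 ^ n * 32 \<le> real (U (Suc n))" by (simp add: slack_def field_simps)
    moreover have "real n < 2 ^ n" by (rule of_nat_less_two_power)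
    ultimately have "real n < real (U (Suc n))" by linarith
    then show ?thesis by simp
  qed
  have "t \<in> h ` X" for t
  proof -
    have "t < 1 * U (Suc t)" using U_grows by simp
    also have "\<dots> \<le> fst (F (Suc t)) * U (Suc t)"
      using feasible_pos[of "Suc t" x0] F(1)[of "Suc t"] x0 by (intro mult_right_mono) (auto simp: C_def Suc_le_eq)
    finally have "t \<in> snd (F (Suc t)) ` C (Suc t)" using F(2)[of "Suc t"] by (simp add: fills_def)
    then show ?thesis using h CX by force
  qed
  moreover have "((x, y) \<in> E i \<longrightarrow> h x div U (Suc i) = h y div U (Suc i)) \<and>
     (h x div U (Suc i) = h y div U (Suc i) \<longrightarrow> (x, y) \<in> E (Suc i))"
    if xy: "x \<in> X" "y \<in> X" for i x y
  proof -
    obtain n where "x \<in> C n" using C_X[OF xy(1)] by blast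
    obtain m where "y \<in> C m" using C_X[OF xy(2)] by blast
    define k where "k = Max {n, m, Suc i}"
    have k: "x \<in> C k" "y \<in> C k" "i < k"
      using C_mono[OF \<open>x \<in> C n\<close>, of k] C_mono[OF \<open>y \<in> C m\<close>, of k] by (auto simp: k_def)
    then show ?thesis using F(2)[of k] h unfolding fills_def by metis
  qed
  ultimately show ?thesis by (intro exI[of _ h]) blast
qed

end

section \<open>Multi-maps\<close>

text \<open>The oscillation bound \<open>\<omega>\<^sub>\<Phi>(\<delta>) \<le> r\<close> in terms of pairs of points; it is enough to test the
  oscillation on two-point sets.\<close>

definition controlled :: "'a metric \<Rightarrow> 'b metric \<Rightarrow> ('a \<times> 'b) set \<Rightarrow> real \<Rightarrow> real \<Rightarrow> bool" where
  "controlled X Y \<Phi> \<delta> r \<longleftrightarrow>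
     (\<forall>x y x' y'. (x, y) \<in> \<Phi> \<longrightarrow> (x', y') \<in> \<Phi> \<longrightarrow> mdist X x x' \<le> \<delta> \<longrightarrow> mdist Y y y' \<le> r)"

lemma controlled_mono: "controlled X Y \<Phi> \<delta> r \<Longrightarrow> r \<le> r' \<Longrightarrow> controlled X Y \<Phi> \<delta> r'"
  unfolding controlled_def by (meson order_trans)

lemma mdist_self: "x \<in> mspace X \<Longrightarrow> mdist X x x = 0"
  by simp

lemma mdiam_le_iff:
  assumes "0 \<le> \<delta>"
  shows "mdiam X A \<le> ennreal \<delta> \<longleftrightarrow> (\<forall>x\<in>A. \<forall>y\<in>A. mdist X x y \<le> \<delta>)"
  using assms by (simp add: mdiam_def SUP_le_iff)

lemma oscillation_le_iff:
  assumes \<Phi>: "\<Phi> \<subseteq> mspace X \<times> mspace Y" and "0 \<le> \<delta>" "0 \<le> r"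
  shows "oscillation X Y \<Phi> \<delta> \<le> ennreal r \<longleftrightarrow> controlled X Y \<Phi> \<delta> r"
proof
  assume osc: "oscillation X Y \<Phi> \<delta> \<le> ennreal r"
  show "controlled X Y \<Phi> \<delta> r"
    unfolding controlled_def
  proof (intro allI impI)
    fix x y x' y' assume a: "(x, y) \<in> \<Phi>" "(x', y') \<in> \<Phi>" "mdist X x x' \<le> \<delta>"
    have x: "x \<in> mspace X" "x' \<in> mspace X" using a \<Phi> by auto
    have "mdiam X {x, x'} \<le> ennreal \<delta>"
      using a x \<open>0 \<le> \<delta>\<close> by (simp add: mdiam_le_iff mdist_commute[of X x' x] mdist_self)
    then have "mdiam Y (\<Phi> `` {x, x'}) \<le> ennreal r"
      using osc x unfolding oscillation_def SUP_le_iff by blast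
    then have "\<forall>y\<in>\<Phi> `` {x, x'}. \<forall>y'\<in>\<Phi> `` {x, x'}. mdist Y y y' \<le> r"
      using \<open>0 \<le> r\<close> by (simp only: mdiam_le_iff)
    then show "mdist Y y y' \<le> r" using a by blast
  qed
next
  assume "controlled X Y \<Phi> \<delta> r"
  then show "oscillation X Y \<Phi> \<delta> \<le> ennreal r"
    unfolding oscillation_def SUP_le_iff controlled_def
    using assms(2,3) by (auto simp: mdiam_le_iff)
qed

lemma macro_uniform_iff:
  "macro_uniform X Y \<Phi> \<longleftrightarrow>
     \<Phi> \<subseteq> mspace X \<times> mspace Y \<and> (\<forall>\<delta>\<ge>0. \<exists>r>0. controlled X Y \<Phi> \<delta> r)"
proof -
  have "oscillation X Y \<Phi> \<delta> < \<infinity> \<longleftrightarrow> (\<exists>r>0. controlled X Y \<Phi> \<delta> r)"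
    if \<Phi>: "\<Phi> \<subseteq> mspace X \<times> mspace Y" and \<delta>: "0 \<le> \<delta>" for \<delta>
  proof
    assume "oscillation X Y \<Phi> \<delta> < \<infinity>"
    then obtain r where r: "0 \<le> r" "oscillation X Y \<Phi> \<delta> = ennreal r"
      by (cases "oscillation X Y \<Phi> \<delta>") auto
    then have "controlled X Y \<Phi> \<delta> r"
      using oscillation_le_iff[OF \<Phi> \<delta> r(1)] by simp
    then show "\<exists>r>0. controlled X Y \<Phi> \<delta> r"
      using r(1) by (intro exI[of _ "r + 1"]) (auto intro: controlled_mono)
  next
    assume "\<exists>r>0. controlled X Y \<Phi> \<delta> r"
    then obtain r where r: "0 < r" "controlled X Y \<Phi> \<delta> r" by blast
    then have "oscillation X Y \<Phi> \<delta> \<le> ennreal r"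
      using oscillation_le_iff[OF \<Phi> \<delta>, of r] by simp
    also have "\<dots> < \<infinity>" by simp
    finally show "oscillation X Y \<Phi> \<delta> < \<infinity>" .
  qed
  then show ?thesis unfolding macro_uniform_def by auto
qed

lemma macro_uniform_equivalence_converse:
  "macro_uniform_equivalence X Y \<Phi> \<Longrightarrow> macro_uniform_equivalence Y X (converse \<Phi>)"
  by (simp add: macro_uniform_equivalence_def)

lemma macro_uniform_equivalenceD:
  assumes "macro_uniform_equivalence X Y \<Phi>"
  shows "\<Phi> \<subseteq> mspace X \<times> mspace Y"
    and "x \<in> mspace X \<Longrightarrow> \<exists>y. (x, y) \<in> \<Phi>"
    and "0 \<le> \<delta> \<Longrightarrow> \<exists>r>0. controlled X Y \<Phi> \<delta> r"
proof -
  have mu: "macro_uniform X Y \<Phi>" and dom: "converse \<Phi> `` mspace Y = mspace X"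
    using assms by (simp_all add: macro_uniform_equivalence_def)
  show "\<Phi> \<subseteq> mspace X \<times> mspace Y" using mu unfolding macro_uniform_iff by (rule conjunct1)
  show "\<exists>y. (x, y) \<in> \<Phi>" if "x \<in> mspace X" using that unfolding dom[symmetric] by blast
  show "\<exists>r>0. controlled X Y \<Phi> \<delta> r" if "0 \<le> \<delta>" using mu that unfolding macro_uniform_iff by simp
qed

lemma macro_uniformly_equivalent_by_map:
  assumes f: "f ` mspace X = mspace Y"
    and fwd: "\<And>\<delta>. 0 \<le> \<delta> \<Longrightarrow> \<exists>r. \<forall>x\<in>mspace X. \<forall>x'\<in>mspace X.
                mdist X x x' \<le> \<delta> \<longrightarrow> mdist Y (f x) (f x') \<le> r"
    and bwd: "\<And>\<delta>. 0 \<le> \<delta> \<Longrightarrow> \<exists>r. \<forall>x\<in>mspace X. \<forall>x'\<in>mspace X.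
                mdist Y (f x) (f x') \<le> \<delta> \<longrightarrow> mdist X x x' \<le> r"
  shows "macro_uniformly_equivalent X Y"
proof -
  define \<Phi> where "\<Phi> = {(x, f x) |x. x \<in> mspace X}"
  have "\<exists>r>0. controlled X Y \<Phi> \<delta> r" if "0 \<le> \<delta>" for \<delta>
  proof -
    obtain r where r: "\<forall>x\<in>mspace X. \<forall>x'\<in>mspace X. mdist X x x' \<le> \<delta> \<longrightarrow> mdist Y (f x) (f x') \<le> r"
      using fwd \<open>0 \<le> \<delta>\<close> by blast
    then have "controlled X Y \<Phi> \<delta> r" by (auto simp: controlled_def \<Phi>_def)
    then show ?thesis by (intro exI[of _ "max r 1"]) (auto intro: controlled_mono)
  qed
  moreover have "\<exists>r>0. controlled Y X (converse \<Phi>) \<delta> r" if "0 \<le> \<delta>" for \<delta>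
  proof -
    obtain r where r: "\<forall>x\<in>mspace X. \<forall>x'\<in>mspace X. mdist Y (f x) (f x') \<le> \<delta> \<longrightarrow> mdist X x x' \<le> r"
      using bwd \<open>0 \<le> \<delta>\<close> by blast
    then have "controlled Y X (converse \<Phi>) \<delta> r" by (auto simp: controlled_def \<Phi>_def)
    then show ?thesis by (intro exI[of _ "max r 1"]) (auto intro: controlled_mono)
  qed
  moreover have "\<Phi> \<subseteq> mspace X \<times> mspace Y" "converse \<Phi> `` mspace Y = mspace X" "\<Phi> `` mspace X = mspace Y"
    unfolding f[symmetric] \<Phi>_def by auto
  ultimately have "macro_uniform_equivalence X Y \<Phi>"
    unfolding macro_uniform_equivalence_def macro_uniform_iff by auto
  then show ?thesis unfolding macro_uniformly_equivalent_def by blast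
qed

section \<open>Covering numbers\<close>

lemma cov_number_le:
  assumes "finite \<C>" "\<C> \<subseteq> Pow (mspace X)" "A \<subseteq> \<Union>\<C>" "0 \<le> \<delta>"
    and "\<And>C x y. C \<in> \<C> \<Longrightarrow> x \<in> C \<Longrightarrow> y \<in> C \<Longrightarrow> mdist X x y \<le> \<delta>"
  shows "cov_number X \<delta> A \<le> enat (card \<C>)"
  unfolding cov_number_def
  by (rule INF_lower) (use assms in \<open>auto simp: mdiam_le_iff\<close>)

lemma cov_number_greatest:
  assumes "0 \<le> \<delta>"
    and "\<And>\<C>. finite \<C> \<Longrightarrow> \<C> \<subseteq> Pow (mspace X) \<Longrightarrow> A \<subseteq> \<Union>\<C> \<Longrightarrow>
           (\<And>C x y. C \<in> \<C> \<Longrightarrow> x \<in> C \<Longrightarrow> y \<in> C \<Longrightarrow> mdist X x y \<le> \<delta>) \<Longrightarrow> n \<le> enat (card \<C>)"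
  shows "n \<le> cov_number X \<delta> A"
  unfolding cov_number_def
proof (rule INF_greatest)
  fix \<C> assume "\<C> \<in> {\<C>. finite \<C> \<and> \<C> \<subseteq> Pow (mspace X) \<and> A \<subseteq> \<Union> \<C> \<and> (\<forall>C\<in>\<C>. mdiam X C \<le> ennreal \<delta>)}"
  then have C: "finite \<C>" "\<C> \<subseteq> Pow (mspace X)" "A \<subseteq> \<Union>\<C>" "\<forall>C\<in>\<C>. mdiam X C \<le> ennreal \<delta>"
    by simp_all
  show "n \<le> enat (card \<C>)"
  proof (rule assms(2)[OF C(1-3)])
    fix C x y assume "C \<in> \<C>" "x \<in> C" "y \<in> C"
    moreover have "mdiam X C \<le> ennreal \<delta>" using C(4) \<open>C \<in> \<C>\<close> by (rule bspec)
    ultimately show "mdist X x y \<le> \<delta>" unfolding mdiam_le_iff[OF assms(1)] by simp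
  qed
qed

text \<open>A set of diameter at most \<open>\<delta>\<close> contains at most one point of a \<open>\<delta>\<close>-separated set.\<close>

lemma separated_le_cov_number:
  assumes "S \<subseteq> A" "0 \<le> \<delta>"
    and sep: "\<And>x y. x \<in> S \<Longrightarrow> y \<in> S \<Longrightarrow> mdist X x y \<le> \<delta> \<Longrightarrow> x = y"
    and n: "infinite S \<or> n \<le> enat (card S)"
  shows "n \<le> cov_number X \<delta> A"
proof (rule cov_number_greatest[OF assms(2)])
  fix \<C> assume \<C>: "finite \<C>" "A \<subseteq> \<Union>\<C>"
    and small: "\<And>C x y. C \<in> \<C> \<Longrightarrow> x \<in> C \<Longrightarrow> y \<in> C \<Longrightarrow> mdist X x y \<le> \<delta>"
  have "\<forall>x\<in>S. \<exists>C\<in>\<C>. x \<in> C" using assms(1) \<C>(2) by blast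
  then obtain c where c: "\<And>x. x \<in> S \<Longrightarrow> c x \<in> \<C> \<and> x \<in> c x" by metis
  have inj: "inj_on c S"
  proof (rule inj_onI)
    fix x y assume xy: "x \<in> S" "y \<in> S" "c x = c y"
    then have "mdist X x y \<le> \<delta>" using c small by metis
    then show "x = y" using sep xy by blast
  qed
  have sub: "c ` S \<subseteq> \<C>" using c by blast
  have "finite S" using inj_on_finite[OF inj sub \<C>(1)] .
  moreover have "card S \<le> card \<C>" using card_inj_on_le[OF inj sub \<C>(1)] .
  ultimately show "n \<le> enat (card \<C>)" using n by (meson enat_ord_simps(1) order_trans)
qed

text \<open>Pull back a cover of the ball in \<open>Y\<close> along \<open>\<Phi>\<close>. This one inequality yields the invariance of
  bounded and of unbounded geometry, and, for the self-equivalences of a homogeneous space, the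
  comparison of all balls with each other.\<close>

lemma cov_number_ball_transfer:
  assumes \<Phi>: "macro_uniform_equivalence X Y \<Phi>" and xy: "(x, y) \<in> \<Phi>"
    and fwd: "controlled X Y \<Phi> \<epsilon> r" and bwd: "controlled Y X (converse \<Phi>) \<delta> \<delta>'"
    and "0 \<le> \<delta>" "0 \<le> \<delta>'"
  shows "cov_number X \<delta>' (mcball_of X x \<epsilon>) \<le> cov_number Y \<delta> (mcball_of Y y r)"
proof (rule cov_number_greatest[OF \<open>0 \<le> \<delta>\<close>])
  fix \<C> assume \<C>: "finite \<C>" "\<C> \<subseteq> Pow (mspace Y)" "mcball_of Y y r \<subseteq> \<Union>\<C>"
    and small: "\<And>C x y. C \<in> \<C> \<Longrightarrow> x \<in> C \<Longrightarrow> y \<in> C \<Longrightarrow> mdist Y x y \<le> \<delta>"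
  note \<Phi>D = macro_uniform_equivalenceD[OF \<Phi>]
  have "cov_number X \<delta>' (mcball_of X x \<epsilon>) \<le> enat (card ((\<lambda>C. converse \<Phi> `` C) ` \<C>))"
  proof (rule cov_number_le)
    show "finite ((\<lambda>C. converse \<Phi> `` C) ` \<C>)" using \<C> by simp
    show "(\<lambda>C. converse \<Phi> `` C) ` \<C> \<subseteq> Pow (mspace X)" using \<Phi>D(1) by auto
    show "0 \<le> \<delta>'" by fact
    show "mcball_of X x \<epsilon> \<subseteq> \<Union> ((\<lambda>C. converse \<Phi> `` C) ` \<C>)"
    proof
      fix a assume "a \<in> mcball_of X x \<epsilon>"
      then have a: "a \<in> mspace X" "mdist X x a \<le> \<epsilon>" by simp_all
      obtain b where b: "(a, b) \<in> \<Phi>" using \<Phi>D(2) a by blast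
      have "mdist Y y b \<le> r" using fwd xy b a unfolding controlled_def by blast
      then have "b \<in> mcball_of Y y r" using b xy \<Phi>D(1) by auto
      then obtain C where "C \<in> \<C>" "b \<in> C" using \<C>(3) by blast
      then show "a \<in> \<Union> ((\<lambda>C. converse \<Phi> `` C) ` \<C>)" using b by blast
    qed
    fix D u w assume "D \<in> (\<lambda>C. converse \<Phi> `` C) ` \<C>" "u \<in> D" "w \<in> D"
    then obtain C u' w' where "C \<in> \<C>" "u' \<in> C" "w' \<in> C" "(u, u') \<in> \<Phi>" "(w, w') \<in> \<Phi>" by blast
    then show "mdist X u w \<le> \<delta>'"
      using bwd small[of C u' w'] unfolding controlled_def by blast
  qed
  also have "\<dots> \<le> enat (card \<C>)" using card_image_le[OF \<C>(1)] by simp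
  finally show "cov_number X \<delta>' (mcball_of X x \<epsilon>) \<le> enat (card \<C>)" .
qed

lemma bounded_geometry_transfer:
  assumes eq: "macro_uniformly_equivalent X Y" and Y: "bounded_geometry Y"
  shows "bounded_geometry X"
proof -
  obtain \<Phi> where \<Phi>: "macro_uniform_equivalence X Y \<Phi>"
    using eq by (auto simp: macro_uniformly_equivalent_def)
  note D = macro_uniform_equivalenceD[OF \<Phi>]
    and D' = macro_uniform_equivalenceD[OF macro_uniform_equivalence_converse[OF \<Phi>]]
  obtain \<delta> where \<delta>: "0 < \<delta>" "\<And>\<epsilon>. 0 < \<epsilon> \<Longrightarrow> upper_cov Y \<delta> \<epsilon> < \<infinity>"
    using Y by (auto simp: bounded_geometry_def)
  obtain \<delta>' where \<delta>': "0 < \<delta>'" "controlled Y X (converse \<Phi>) \<delta> \<delta>'" using D'(3)[of \<delta>] \<delta> by auto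
  have "upper_cov X \<delta>' \<epsilon> < \<infinity>" if "0 < \<epsilon>" for \<epsilon>
  proof -
    obtain r where r: "0 < r" "controlled X Y \<Phi> \<epsilon> r" using D(3)[of \<epsilon>] \<open>0 < \<epsilon>\<close> by auto
    have "cov_number X \<delta>' (mcball_of X x \<epsilon>) \<le> upper_cov Y \<delta> r" if "x \<in> mspace X" for x
    proof -
      obtain y where y: "(x, y) \<in> \<Phi>" using D(2) \<open>x \<in> mspace X\<close> by blast
      have "cov_number X \<delta>' (mcball_of X x \<epsilon>) \<le> cov_number Y \<delta> (mcball_of Y y r)"
        using cov_number_ball_transfer[OF \<Phi> y r(2) \<delta>'(2)] \<delta> \<delta>' by simp
      also have "\<dots> \<le> upper_cov Y \<delta> r"
        unfolding upper_cov_def by (rule SUP_upper) (use y D(1) in auto)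
      finally show ?thesis .
    qed
    then have "upper_cov X \<delta>' \<epsilon> \<le> upper_cov Y \<delta> r"
      unfolding upper_cov_def[of X] by (rule SUP_least)
    then show ?thesis using \<delta>(2)[OF r(1)] by (rule le_less_trans)
  qed
  then show ?thesis using \<delta>' by (auto simp: bounded_geometry_def)
qed

lemma unbounded_geometry_transfer:
  assumes eq: "macro_uniformly_equivalent X Y" and Y: "unbounded_geometry Y"
  shows "unbounded_geometry X"
  unfolding unbounded_geometry_def
proof (intro allI impI)
  fix \<delta> :: real assume \<delta>: "0 < \<delta>"
  obtain \<Phi> where \<Phi>: "macro_uniform_equivalence X Y \<Phi>"
    using eq by (auto simp: macro_uniformly_equivalent_def)
  note \<Psi> = macro_uniform_equivalence_converse[OF \<Phi>]
  note D = macro_uniform_equivalenceD[OF \<Phi>] and D' = macro_uniform_equivalenceD[OF \<Psi>]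
  obtain \<delta>' where \<delta>': "0 < \<delta>'" "controlled X Y \<Phi> \<delta> \<delta>'" using D(3)[of \<delta>] \<delta> by auto
  obtain \<epsilon> where \<epsilon>: "0 < \<epsilon>" "\<infinity> \<le> lower_cov Y \<delta>' \<epsilon>"
    using Y \<delta>'(1) unfolding unbounded_geometry_def by blast
  obtain r where r: "0 < r" "controlled Y X (converse \<Phi>) \<epsilon> r" using D'(3)[of \<epsilon>] \<epsilon> by auto
  have "\<infinity> \<le> lower_cov X \<delta> r"
    unfolding lower_cov_def
  proof (rule INF_greatest)
    fix x assume "x \<in> mspace X"
    then obtain y where y: "(x, y) \<in> \<Phi>" using D(2) by blast
    have "\<infinity> \<le> lower_cov Y \<delta>' \<epsilon>" by (rule \<epsilon>(2))
    also have "\<dots> \<le> cov_number Y \<delta>' (mcball_of Y y \<epsilon>)"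
      unfolding lower_cov_def by (rule INF_lower) (use y D(1) in auto)
    also have "\<dots> \<le> cov_number X \<delta> (mcball_of X x r)"
      using cov_number_ball_transfer[OF \<Psi> _ r(2), of y x \<delta> \<delta>'] y \<delta> \<delta>' by simp
    finally show "\<infinity> \<le> cov_number X \<delta> (mcball_of X x r)" .
  qed
  then show "\<exists>\<epsilon>>0. \<infinity> \<le> lower_cov X \<delta> \<epsilon>" using r by blast
qed

lemma bounded_metric_iff:
  "bounded_metric X \<longleftrightarrow> (\<exists>B. \<forall>x\<in>mspace X. \<forall>y\<in>mspace X. mdist X x y \<le> B)"
  unfolding bounded_metric_def by (simp add: Metric_space.mbounded_alt)

lemma bounded_metric_transfer:
  assumes eq: "macro_uniformly_equivalent X Y" and Y: "bounded_metric Y"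
  shows "bounded_metric X"
proof -
  obtain \<Phi> where \<Phi>: "macro_uniform_equivalence X Y \<Phi>"
    using eq by (auto simp: macro_uniformly_equivalent_def)
  note D = macro_uniform_equivalenceD[OF \<Phi>]
    and D' = macro_uniform_equivalenceD[OF macro_uniform_equivalence_converse[OF \<Phi>]]
  obtain B where B: "\<forall>x\<in>mspace Y. \<forall>y\<in>mspace Y. mdist Y x y \<le> B"
    using Y by (auto simp: bounded_metric_iff)
  obtain r where r: "controlled Y X (converse \<Phi>) (max B 0) r" using D'(3)[of "max B 0"] by auto
  have "mdist X x x' \<le> r" if x: "x \<in> mspace X" "x' \<in> mspace X" for x x'
  proof -
    obtain y where y: "(x, y) \<in> \<Phi>" using D(2)[OF x(1)] by blast
    obtain y' where y': "(x', y') \<in> \<Phi>" using D(2)[OF x(2)] by blast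
    have "mdist Y y y' \<le> max B 0" using B y y' D(1) by (auto simp: le_max_iff_disj)
    then show ?thesis using r y y' unfolding controlled_def by blast
  qed
  then show ?thesis unfolding bounded_metric_iff by blast
qed

lemma unbounded_far:
  assumes "\<not> bounded_metric X" "x \<in> mspace X"
  shows "\<exists>y\<in>mspace X. B < mdist X x y"
proof (rule ccontr)
  assume "\<not> ?thesis"
  then have near: "\<And>y. y \<in> mspace X \<Longrightarrow> mdist X x y \<le> B" by (auto simp: not_less)
  have "mdist X y z \<le> B + B" if "y \<in> mspace X" "z \<in> mspace X" for y z
    using mdist_triangle[of y X x z] mdist_commute[of X y x] near[OF that(1)] near[OF that(2)] assms(2) that
    by linarith
  then show False using assms(1) unfolding bounded_metric_iff by blast
qed

lemma bounded_equivalent_singleton: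
  assumes "mspace X \<noteq> {}" "bounded_metric X"
  shows "macro_uniformly_equivalent X singleton_metric"
proof (rule macro_uniformly_equivalent_by_map[of "\<lambda>_. 0"])
  show "(\<lambda>_. 0) ` mspace X = mspace singleton_metric" using assms(1) by auto
qed (use assms(2) in \<open>auto simp: bounded_metric_iff\<close>)

section \<open>The model spaces\<close>

lemma fin_seqs_update:
  assumes "x \<in> fin_seqs K" "k \<in> K"
  shows "x(Suc n := k) \<in> fin_seqs K"
proof -
  have x: "x \<in> {1..} \<rightarrow>\<^sub>E K" using assms by (simp add: fin_seqs_def)
  have "\<exists>m\<ge>1. \<forall>i>m. x i = 0" using assms unfolding fin_seqs_def by simp
  then obtain m where m: "\<forall>i>m. x i = 0" by blast
  have "x(Suc n := k) \<in> {1..} \<rightarrow>\<^sub>E K"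
    using x assms(2) by (simp add: PiE_iff extensional_def)
  moreover have "\<forall>i>max m (Suc n). (x(Suc n := k)) i = 0" using m by simp
  ultimately show ?thesis
    unfolding fin_seqs_def by (intro CollectI conjI exI[of _ "max m (Suc n)"]) auto
qed

lemma last_diff_update:
  assumes "x \<in> fin_seqs K" "k \<in> K" "l \<in> K"
  shows "last_diff (x(Suc n := k)) (x(Suc n := l)) \<le> real m \<longleftrightarrow> k = l \<or> Suc n \<le> m"
  using last_diff_le_iff[OF fin_seqs_update[OF assms(1,2)] fin_seqs_update[OF assms(1,3)], of n n m]
  by (auto simp: not_less[symmetric])

text \<open>Changing the digit at a position beyond \<open>\<delta>\<close> gives infinitely many points at mutual distances
  larger than \<open>\<delta>\<close>.\<close>

lemma unbounded_geometry_baire: "unbounded_geometry baire_macro_space"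
  unfolding unbounded_geometry_def
proof (intro allI impI)
  fix \<delta> :: real assume \<delta>: "0 < \<delta>"
  define n where "n = nat \<lfloor>\<delta>\<rfloor>"
  have n: "\<delta> < real (Suc n)" using \<delta> by (simp add: n_def) linarith
  have "\<infinity> \<le> lower_cov baire_macro_space \<delta> (real (Suc n))"
    unfolding lower_cov_def
  proof (rule INF_greatest)
    fix x assume "x \<in> mspace baire_macro_space"
    then have x: "x \<in> fin_seqs UNIV" by (simp add: baire_macro_space_def)
    define S where "S = range (\<lambda>k. x(Suc n := k))"
    have "inj (\<lambda>k. x(Suc n := k))" by (intro injI) (metis fun_upd_same)
    then have inf: "infinite S" unfolding S_def by (simp add: finite_image_iff)
    show "\<infinity> \<le> cov_number baire_macro_space \<delta> (mcball_of baire_macro_space x (real (Suc n)))"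
    proof (rule separated_le_cov_number)
      show "S \<subseteq> mcball_of baire_macro_space x (real (Suc n))"
      proof
        fix y assume "y \<in> S"
        then obtain k where k: "y = x(Suc n := k)" by (auto simp: S_def)
        have "last_diff x y \<le> real (Suc n)"
          using last_diff_update[OF x UNIV_I UNIV_I, of n "x (Suc n)" k "Suc n"] k by simp
        then show "y \<in> mcball_of baire_macro_space x (real (Suc n))"
          using x k fin_seqs_update[OF x] by (simp add: baire_macro_space_def)
      qed
      fix y z assume "y \<in> S" "z \<in> S" "mdist baire_macro_space y z \<le> \<delta>"
      then obtain k l where kl: "y = x(Suc n := k)" "z = x(Suc n := l)" "last_diff y z \<le> \<delta>"
        by (auto simp: S_def baire_macro_space_def)
      have "last_diff y z \<le> real n"
        using kl(3) n unfolding last_diff_def by simp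
      then have "k = l" using last_diff_update[OF x UNIV_I UNIV_I, of n k l n] kl by simp
      then show "y = z" using kl by simp
    qed (use \<delta> inf in auto)
  qed
  then show "\<exists>\<epsilon>>0. \<infinity> \<le> lower_cov baire_macro_space \<delta> \<epsilon>"
    by (intro exI[of _ "real (Suc n)"]) auto
qed

lemma zero_in_fin_seqs: "0 \<in> K \<Longrightarrow> (\<lambda>i. if i \<ge> 1 then 0 else undefined) \<in> fin_seqs K"
  unfolding fin_seqs_def by (auto simp: PiE_iff extensional_def intro!: exI[of _ 1])

lemma unbounded_cantor: "\<not> bounded_metric cantor_macro_cube"
proof
  assume "bounded_metric cantor_macro_cube"
  then obtain B where B: "\<And>x y. x \<in> fin_seqs {0, 1} \<Longrightarrow> y \<in> fin_seqs {0, 1} \<Longrightarrow> last_diff x y \<le> B"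
    by (auto simp: bounded_metric_iff cantor_macro_cube_def)
  define n where "n = nat \<lceil>B\<rceil>"
  have n: "B \<le> real n" unfolding n_def by (rule real_nat_ceiling_ge)
  obtain x where x: "x \<in> fin_seqs {0, 1 :: nat}" using zero_in_fin_seqs[of "{0,1}"] by blast
  have "last_diff (x(Suc n := 0)) (x(Suc n := 1)) \<le> B"
    using B fin_seqs_update[OF x] by blast
  then have "last_diff (x(Suc n := 0)) (x(Suc n := 1)) \<le> real n" using n by linarith
  then show False using last_diff_update[OF x, of 0 1 n n] by simp
qed

text \<open>A ball of integer radius \<open>n\<close> has at most \<open>2 ^ n\<close> points.\<close>

lemma bounded_geometry_cantor: "bounded_geometry cantor_macro_cube"
  unfolding bounded_geometry_def
proof (intro exI[of _ 1] conjI allI impI)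
  fix \<epsilon> :: real
  define n where "n = nat \<lceil>\<epsilon>\<rceil>"
  have n: "\<epsilon> \<le> real n" unfolding n_def by (rule real_nat_ceiling_ge)
  define P where "P = ({1..n} \<rightarrow>\<^sub>E {0, 1 :: nat})"
  have finP: "finite P" by (simp add: P_def finite_PiE)
  have "cov_number cantor_macro_cube 1 (mcball_of cantor_macro_cube x \<epsilon>) \<le> enat (card P)"
    if "x \<in> mspace cantor_macro_cube" for x
  proof -
    have x: "x \<in> fin_seqs {0, 1}" using that by (simp add: cantor_macro_cube_def)
    define B where "B = mcball_of cantor_macro_cube x \<epsilon>"
    have "B \<subseteq> (\<lambda>z i. if i \<in> {1..n} then z i else x i) ` P"
    proof
      fix y assume "y \<in> B"
      then have y: "y \<in> fin_seqs {0, 1}" "last_diff x y \<le> \<epsilon>"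
        by (auto simp: B_def cantor_macro_cube_def)
      have "last_diff x y \<le> real n" using y n by linarith
      then have agree: "\<forall>i>n. x i = y i" using last_diff_le_iff[OF x y(1)] by simp
      have yE: "y \<in> {1..} \<rightarrow>\<^sub>E {0, 1}" and xE: "x \<in> {1..} \<rightarrow>\<^sub>E {0, 1}"
        using x y by (simp_all add: fin_seqs_def)
      have "x 0 = y 0" using xE yE by (simp add: PiE_iff extensional_def)
      then have "y = (\<lambda>i. if i \<in> {1..n} then restrict y {1..n} i else x i)"
        using agree by (auto simp: fun_eq_iff not_le Suc_le_eq)
      moreover have "restrict y {1..n} \<in> P"
        using yE unfolding P_def by (simp add: PiE_iff)
      ultimately show "y \<in> (\<lambda>z i. if i \<in> {1..n} then z i else x i) ` P" by blast
    qed
    then have fin: "finite B" and card: "card B \<le> card P"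
      using finP surj_card_le finite_surj by blast+
    have "cov_number cantor_macro_cube 1 B \<le> enat (card ((\<lambda>y. {y}) ` B))"
    proof (rule cov_number_le)
      show "(\<lambda>y. {y}) ` B \<subseteq> Pow (mspace cantor_macro_cube)" by (auto simp: B_def)
    qed (use fin in \<open>auto simp: cantor_macro_cube_def last_diff_def\<close>)
    also have "\<dots> \<le> enat (card P)"
      using card_image_le[OF fin, of "\<lambda>y. {y}"] card by simp
    finally show ?thesis by (simp add: B_def)
  qed
  then have "upper_cov cantor_macro_cube 1 \<epsilon> \<le> enat (card P)"
    unfolding upper_cov_def by (rule SUP_least)
  then show "upper_cov cantor_macro_cube 1 \<epsilon> < \<infinity>"
    using enat_ord_code(4) le_less_trans by blast
qed simp

section \<open>Coarse homogeneity\<close>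

text \<open>Homogeneity makes the covering numbers at different centres comparable, at the price of
  changing the scales \<open>\<delta>\<close> and \<open>\<epsilon>\<close> by the uniform gauge \<open>\<phi>\<close>.\<close>

lemma homogeneous_cov_number:
  assumes "coarsely_homogeneous X"
  shows "\<exists>\<phi>. (\<forall>\<delta>\<ge>0. 0 \<le> \<phi> \<delta>) \<and>
     (\<forall>x\<in>mspace X. \<forall>y\<in>mspace X. \<forall>\<delta>\<ge>0. \<forall>\<epsilon>\<ge>0. \<forall>\<delta>'\<ge>\<phi> \<delta>. \<forall>r\<ge>\<phi> \<epsilon>.
        cov_number X \<delta>' (mcball_of X x \<epsilon>) \<le> cov_number X \<delta> (mcball_of X y r))"
proof -
  obtain \<phi> where \<phi>: "\<forall>\<delta>\<ge>0. 0 \<le> \<phi> \<delta>" and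
    hom: "\<forall>x\<in>mspace X. \<forall>y\<in>mspace X. \<exists>\<Phi>. macro_uniform_equivalence X X \<Phi> \<and>
           y \<in> \<Phi> `` {x} \<and>
           (\<forall>\<delta>\<ge>0. oscillation X X \<Phi> \<delta> \<le> ennreal (\<phi> \<delta>)) \<and>
           (\<forall>\<delta>\<ge>0. oscillation X X (converse \<Phi>) \<delta> \<le> ennreal (\<phi> \<delta>))"
    using assms unfolding coarsely_homogeneous_def by (elim exE conjE)
  have "cov_number X \<delta>' (mcball_of X x \<epsilon>) \<le> cov_number X \<delta> (mcball_of X y r)"
    if xy: "x \<in> mspace X" "y \<in> mspace X" and ge: "0 \<le> \<delta>" "0 \<le> \<epsilon>" "\<phi> \<delta> \<le> \<delta>'" "\<phi> \<epsilon> \<le> r"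
    for x y \<delta> \<epsilon> \<delta>' r
  proof -
    obtain \<Phi> where \<Phi>: "macro_uniform_equivalence X X \<Phi>" "y \<in> \<Phi> `` {x}"
      "oscillation X X \<Phi> \<epsilon> \<le> ennreal (\<phi> \<epsilon>)" "oscillation X X (converse \<Phi>) \<delta> \<le> ennreal (\<phi> \<delta>)"
      using hom[rule_format, OF xy] ge by blast
    have sub: "\<Phi> \<subseteq> mspace X \<times> mspace X" "converse \<Phi> \<subseteq> mspace X \<times> mspace X"
      using macro_uniform_equivalenceD(1)[OF \<Phi>(1)] by auto
    have "controlled X X \<Phi> \<epsilon> (\<phi> \<epsilon>)" "controlled X X (converse \<Phi>) \<delta> (\<phi> \<delta>)"
      using \<Phi>(3,4) oscillation_le_iff[OF sub(1), of \<epsilon> "\<phi> \<epsilon>"] oscillation_le_iff[OF sub(2), of \<delta> "\<phi> \<delta>"] \<phi> ge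
      by auto
    then have "controlled X X \<Phi> \<epsilon> r" "controlled X X (converse \<Phi>) \<delta> \<delta>'"
      using controlled_mono ge by blast+
    then show ?thesis
      using cov_number_ball_transfer[OF \<Phi>(1), of x y \<epsilon> r \<delta> \<delta>'] \<Phi>(2) ge \<phi> by force
  qed
  then show ?thesis using \<phi> by (intro exI[of _ \<phi>] conjI) simp_all
qed

text \<open>If the geometry is not unbounded, for some \<open>\<delta>\<close> every radius admits a ball with a finite covering
  number, and this number bounds those of all balls.\<close>

lemma homogeneous_dichotomy:
  assumes hom: "coarsely_homogeneous X" and "\<not> unbounded_geometry X"
  shows "bounded_geometry X"
proof -
  obtain \<phi> where \<phi>: "\<forall>\<delta>\<ge>0. 0 \<le> \<phi> \<delta>" and
    cov: "\<forall>x\<in>mspace X. \<forall>y\<in>mspace X. \<forall>\<delta>\<ge>0. \<forall>\<epsilon>\<ge>0. \<forall>\<delta>'\<ge>\<phi> \<delta>. \<forall>r\<ge>\<phi> \<epsilon>.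
        cov_number X \<delta>' (mcball_of X x \<epsilon>) \<le> cov_number X \<delta> (mcball_of X y r)"
    using homogeneous_cov_number[OF hom] by (elim exE conjE)
  obtain \<delta> where \<delta>: "0 < \<delta>" "\<And>\<epsilon>. 0 < \<epsilon> \<Longrightarrow> \<not> \<infinity> \<le> lower_cov X \<delta> \<epsilon>"
    using assms(2) unfolding unbounded_geometry_def by auto
  show ?thesis
    unfolding bounded_geometry_def
  proof (intro exI[of _ "max 1 (\<phi> \<delta>)"] conjI allI impI)
    fix \<epsilon> :: real assume \<epsilon>: "0 < \<epsilon>"
    define r where "r = max 1 (\<phi> \<epsilon>)"
    have "\<not> (\<forall>y\<in>mspace X. \<infinity> \<le> cov_number X \<delta> (mcball_of X y r))"
      using \<delta>(2)[of r] unfolding lower_cov_def le_INF_iff by (simp add: r_def)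
    then obtain y where y: "y \<in> mspace X" "cov_number X \<delta> (mcball_of X y r) < \<infinity>"
      by (auto simp: not_le)
    have "upper_cov X (max 1 (\<phi> \<delta>)) \<epsilon> \<le> cov_number X \<delta> (mcball_of X y r)"
      unfolding upper_cov_def
      by (rule SUP_least, rule cov[rule_format]) (use y \<delta> \<epsilon> in \<open>auto simp: r_def\<close>)
    then show "upper_cov X (max 1 (\<phi> \<delta>)) \<epsilon> < \<infinity>" using y(2) by (rule le_less_trans)
  qed simp
qed

lemma separated_sets:
  assumes unb: "\<not> bounded_metric X" and x0: "x0 \<in> mspace X"
  shows "\<exists>S\<subseteq>mspace X. finite S \<and> card S = n \<and> (\<forall>x\<in>S. \<forall>y\<in>S. mdist X x y \<le> s \<longrightarrow> x = y)"
proof (induction n)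
  case 0
  then show ?case by (intro exI[of _ "{}"]) auto
next
  case (Suc n)
  then obtain S where S: "S \<subseteq> mspace X" "finite S" "card S = n"
    "\<forall>x\<in>S. \<forall>y\<in>S. mdist X x y \<le> s \<longrightarrow> x = y" by (elim exE conjE)
  define B where "B = (\<Sum>z\<in>S. mdist X x0 z)"
  have B: "mdist X x0 z \<le> B" if "z \<in> S" for z
    unfolding B_def by (rule member_le_sum) (use S that in auto)
  obtain w where w: "w \<in> mspace X" "B + max s 0 < mdist X x0 w"
    using unbounded_far[OF unb x0] by blast
  have far: "s < mdist X w z \<and> s < mdist X z w \<and> w \<noteq> z" if z: "z \<in> S" for z
  proof -
    have "mdist X x0 w \<le> mdist X x0 z + mdist X z w"
      by (rule mdist_triangle) (use x0 w z S in auto)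
    then show ?thesis using B[OF z] w mdist_commute[of X z w] by auto
  qed
  show ?case
  proof (intro exI[of _ "insert w S"] conjI)
    have "w \<notin> S" using far by blast
    then show "card (insert w S) = Suc n" using S by simp
    show "\<forall>x\<in>insert w S. \<forall>y\<in>insert w S. mdist X x y \<le> s \<longrightarrow> x = y"
    proof (intro ballI impI)
      fix x y assume "x \<in> insert w S" "y \<in> insert w S" "mdist X x y \<le> s"
      then consider "x = y" | "x \<in> S" "y \<in> S" | "x = w" "y \<in> S" | "x \<in> S" "y = w" by blast
      then show "x = y"
        using S(4) far \<open>mdist X x y \<le> s\<close> by cases (auto simp: not_le[symmetric])
    qed
  qed (use S w in auto)
qed

text \<open>An unbounded space contains arbitrarily large finite separated sets; homogeneity turns this
  into a lower bound for the covering numbers that is uniform in the centre.\<close>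

lemma homogeneous_growth:
  assumes hom: "coarsely_homogeneous X" and unb: "\<not> bounded_metric X" and x0: "x0 \<in> mspace X"
    and \<delta>: "0 < \<delta>"
  shows "\<exists>\<epsilon>>0. \<forall>y\<in>mspace X. enat n \<le> cov_number X \<delta> (mcball_of X y \<epsilon>)"
proof -
  obtain \<phi> where \<phi>: "\<forall>\<delta>\<ge>0. 0 \<le> \<phi> \<delta>" and
    cov: "\<forall>x\<in>mspace X. \<forall>y\<in>mspace X. \<forall>\<delta>\<ge>0. \<forall>\<epsilon>\<ge>0. \<forall>\<delta>'\<ge>\<phi> \<delta>. \<forall>r\<ge>\<phi> \<epsilon>.
        cov_number X \<delta>' (mcball_of X x \<epsilon>) \<le> cov_number X \<delta> (mcball_of X y r)"
    using homogeneous_cov_number[OF hom] by (elim exE conjE)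
  obtain S where S: "S \<subseteq> mspace X" "finite S" "card S = n"
    "\<forall>x\<in>S. \<forall>y\<in>S. mdist X x y \<le> \<phi> \<delta> \<longrightarrow> x = y"
    using separated_sets[OF unb x0, of n "\<phi> \<delta>"] by (elim exE conjE)
  define \<epsilon> where "\<epsilon> = (\<Sum>z\<in>S. mdist X x0 z)"
  have \<epsilon>0: "0 \<le> \<epsilon>" unfolding \<epsilon>_def by (rule sum_nonneg) simp
  have \<epsilon>: "mdist X x0 z \<le> \<epsilon>" if "z \<in> S" for z
    unfolding \<epsilon>_def by (rule member_le_sum) (use S that in auto)
  have "enat n \<le> cov_number X \<delta> (mcball_of X y (max 1 (\<phi> \<epsilon>)))" if y: "y \<in> mspace X" for y
  proof -
    have "enat n \<le> cov_number X (\<phi> \<delta>) (mcball_of X x0 \<epsilon>)"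
      by (rule separated_le_cov_number[of S]) (use S \<epsilon> x0 \<phi> \<delta> in auto)
    also have "\<dots> \<le> cov_number X \<delta> (mcball_of X y (max 1 (\<phi> \<epsilon>)))"
      by (rule cov[rule_format]) (use x0 y \<delta> \<epsilon>0 in auto)
    finally show ?thesis .
  qed
  then show ?thesis by (intro exI[of _ "max 1 (\<phi> \<epsilon>)"]) auto
qed

section \<open>The tower of coarse components\<close>

text \<open>The tower induces the coarse structure of \<open>M\<close>. That close points are equivalent even at
  level 0 makes all classes open, hence countable in number if \<open>M\<close> is separable.\<close>

locale metric_tower = tower "mspace M" E for M :: "'a metric" and E +
  assumes E_near: "\<exists>i. \<forall>x\<in>mspace M. \<forall>y\<in>mspace M. mdist M x y \<le> \<delta> \<longrightarrow> (x, y) \<in> E i"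
    and E_unit: "x \<in> mspace M \<Longrightarrow> y \<in> mspace M \<Longrightarrow> mdist M x y \<le> 1 \<Longrightarrow> (x, y) \<in> E 0"
    and E_bounded: "\<exists>D>0. \<forall>x y. (x, y) \<in> E i \<longrightarrow> mdist M x y \<le> D"

definition jumps :: "'a metric \<Rightarrow> real \<Rightarrow> ('a \<times> 'a) set" where
  "jumps X \<epsilon> = {(x, y). x \<in> mspace X \<and> y \<in> mspace X \<and> mdist X x y \<le> \<epsilon>}"

lemma rtrancl_jumps_component:
  assumes "(x, y) \<in> (jumps X \<epsilon>)\<^sup>*" "x \<in> mspace X"
  shows "y \<in> eps_component X \<epsilon> x"
proof -
  obtain n where "(x, y) \<in> jumps X \<epsilon> ^^ n"
    using assms(1) rtrancl_imp_relpow by blast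
  then obtain s where s: "s 0 = x" "s n = y" "\<forall>i<n. (s i, s (Suc i)) \<in> jumps X \<epsilon>"
    unfolding relpow_fun_conv by blast
  have "s i \<in> mspace X" if "i \<le> n" for i
    using s assms(2) that by (cases i) (auto simp: jumps_def Suc_le_eq)
  then show ?thesis
    unfolding eps_component_def using s
    by (intro CollectI exI[of _ n] exI[of _ s]) (auto simp: jumps_def)
qed

text \<open>The tower of components at the scales 1, 2, 3, ...; that their diameters are uniformly bounded is
  what asymptotic dimension zero means.\<close>

lemma component_tower:
  assumes "asymptotic_dimension_zero X"
  shows "\<exists>E. metric_tower X E"
proof -
  define E where "E i = (jumps X (real (Suc i)))\<^sup>* \<inter> mspace X \<times> mspace X" for i
  have sym: "sym (jumps X \<epsilon>)" for \<epsilon>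
    by (intro symI) (auto simp: jumps_def mdist_commute)
  have mono: "jumps X \<epsilon> \<subseteq> jumps X \<epsilon>'" if "\<epsilon> \<le> \<epsilon>'" for \<epsilon> \<epsilon>'
    using that by (auto simp: jumps_def)
  have jump: "(x, y) \<in> E i" if "x \<in> mspace X" "y \<in> mspace X" "mdist X x y \<le> real (Suc i)" for x y i
    using that by (auto simp: E_def jumps_def)
  have near: "(x, y) \<in> E (nat \<lceil>\<delta>\<rceil>)" if "x \<in> mspace X" "y \<in> mspace X" "mdist X x y \<le> \<delta>" for x y \<delta>
    using that(3) real_nat_ceiling_ge[of \<delta>] by (intro jump that) linarith
  have "metric_tower X E"
  proof unfold_locales
    show "equiv (mspace X) (E i)" for i
    proof (rule equivI)
      show "E i \<subseteq> mspace X \<times> mspace X" by (simp add: E_def)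
      show "refl_on (mspace X) (E i)" by (auto simp: refl_on_def E_def)
      show "sym_on UNIV (E i)"
        using sym_rtrancl[OF sym] by (auto simp: E_def sym_def)
      show "trans_on UNIV (E i)"
        unfolding E_def by (intro transI) (auto intro: rtrancl_trans)
    qed
    show "E i \<subseteq> E (Suc i)" for i
      using rtrancl_mono[OF mono[of "real (Suc i)" "real (Suc (Suc i))"]] by (auto simp: E_def)
    show "\<exists>i. (x, y) \<in> E i" if "x \<in> mspace X" "y \<in> mspace X" for x y
      using near[OF that order_refl] by blast
    show "\<exists>i. \<forall>x\<in>mspace X. \<forall>y\<in>mspace X. mdist X x y \<le> \<delta> \<longrightarrow> (x, y) \<in> E i" for \<delta>
      using near by blast
    show "(x, y) \<in> E 0" if "x \<in> mspace X" "y \<in> mspace X" "mdist X x y \<le> 1" for x y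
      using jump[of x y 0] that by simp
    show "\<exists>D>0. \<forall>x y. (x, y) \<in> E i \<longrightarrow> mdist X x y \<le> D" for i
    proof -
      define Z where "Z = (SUP x\<in>mspace X. mdiam X (eps_component X (real (Suc i)) x))"
      have "(0::real) < real (Suc i)" by simp
      then have "Z < \<infinity>"
        using assms unfolding asymptotic_dimension_zero_def Z_def by blast
      then obtain D where D: "0 \<le> D" "Z = ennreal D" by (cases Z) auto
      have "mdist X x y \<le> D" if xy: "(x, y) \<in> E i" for x y
      proof -
        have x: "x \<in> mspace X" using xy by (simp add: E_def)
        have "mdiam X (eps_component X (real (Suc i)) x) \<le> ennreal D"
          unfolding D(2)[symmetric] Z_def by (rule SUP_upper[OF x])
        moreover have "x \<in> eps_component X (real (Suc i)) x"
          using x by (intro rtrancl_jumps_component) auto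
        moreover have "y \<in> eps_component X (real (Suc i)) x"
          using xy by (intro rtrancl_jumps_component) (auto simp: E_def)
        ultimately show ?thesis using D(1) by (simp add: mdiam_le_iff)
      qed
      then show ?thesis using D(1) by (intro exI[of _ "D + 1"]) (auto intro: order_trans[of _ D])
    qed
  qed
  then show ?thesis by blast
qed

context metric_tower
begin

lemma cov_number_le_classes:
  assumes diam: "\<And>x y. (x, y) \<in> E k \<Longrightarrow> mdist M x y \<le> \<delta>" and "0 \<le> \<delta>"
    and I: "finite I" "I \<subseteq> mspace M" and A: "A \<subseteq> (\<Union>r\<in>I. E k `` {r})"
  shows "cov_number M \<delta> A \<le> enat (card I)"
proof -
  have "cov_number M \<delta> A \<le> enat (card ((\<lambda>r. E k `` {r}) ` I))"
  proof (rule cov_number_le)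
    show "(\<lambda>r. E k `` {r}) ` I \<subseteq> Pow (mspace M)" using E_in by blast
    fix C x y assume "C \<in> (\<lambda>r. E k `` {r}) ` I" "x \<in> C" "y \<in> C"
    then obtain r where r: "(r, x) \<in> E k" "(r, y) \<in> E k" by blast
    have "(x, y) \<in> E k" using E_trans[OF E_sym[OF r(1)] r(2)] .
    then show "mdist M x y \<le> \<delta>" by (rule diam)
  qed (use I A \<open>0 \<le> \<delta>\<close> in auto)
  also have "\<dots> \<le> enat (card I)" using card_image_le[OF I(1)] by simp
  finally show ?thesis .
qed

lemma equivalent_to_fin_seqs:
  assumes f: "f ` mspace M = fin_seqs K"
    and fwd: "\<And>i. \<exists>m::nat. \<forall>x y. (x, y) \<in> E i \<longrightarrow> last_diff (f x) (f y) \<le> real m"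
    and bwd: "\<And>m::nat. \<exists>i. \<forall>x\<in>mspace M. \<forall>y\<in>mspace M. last_diff (f x) (f y) \<le> real m \<longrightarrow> (x, y) \<in> E i"
  shows "macro_uniformly_equivalent M (fin_seq_metric K)"
proof (rule macro_uniformly_equivalent_by_map)
  show "f ` mspace M = mspace (fin_seq_metric K)" using f by simp
  fix \<delta> :: real
  obtain i where i: "\<forall>x\<in>mspace M. \<forall>y\<in>mspace M. mdist M x y \<le> \<delta> \<longrightarrow> (x, y) \<in> E i"
    using E_near by blast
  obtain m :: nat where "\<forall>x y. (x, y) \<in> E i \<longrightarrow> last_diff (f x) (f y) \<le> real m" using fwd by blast
  then show "\<exists>r. \<forall>x\<in>mspace M. \<forall>x'\<in>mspace M. mdist M x x' \<le> \<delta> \<longrightarrow> mdist (fin_seq_metric K) (f x) (f x') \<le> r"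
    using i by (intro exI[of _ "real m"]) simp
  obtain j where j: "\<forall>x\<in>mspace M. \<forall>y\<in>mspace M. last_diff (f x) (f y) \<le> real (nat \<lceil>\<delta>\<rceil>) \<longrightarrow> (x, y) \<in> E j"
    using bwd by blast
  obtain D where "\<forall>x y. (x, y) \<in> E j \<longrightarrow> mdist M x y \<le> D" using E_bounded by blast
  then show "\<exists>r. \<forall>x\<in>mspace M. \<forall>x'\<in>mspace M. mdist (fin_seq_metric K) (f x) (f x') \<le> \<delta> \<longrightarrow> mdist M x x' \<le> r"
    using j order_trans[OF _ real_nat_ceiling_ge[of \<delta>]] by (intro exI[of _ D]) simp
qed

end

section \<open>Unbounded geometry\<close>

lemma countable_infinite_labelling:
  assumes "countable S" "infinite S"
  shows "\<exists>b :: 'b \<Rightarrow> nat. bij_betw b S UNIV \<and> (a \<in> S \<longrightarrow> b a = 0)"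
proof -
  define b where "b = Transposition.transpose 0 (to_nat_on S a) \<circ> to_nat_on S"
  have "bij_betw b S UNIV"
    unfolding b_def by (rule bij_betw_trans[OF to_nat_on_infinite[OF assms] bij_transpose])
  moreover have "b a = 0" by (simp add: b_def)
  ultimately show ?thesis by blast
qed

context tower
begin

lemma class_subset_quotient: "y \<in> E (Suc i) `` {x} \<Longrightarrow> E i `` {y} \<in> E (Suc i) `` {x} // E i"
  by (rule quotientI)

text \<open>If every class splits into a countable infinity of subclasses, these can be labelled by all of
  \<open>\<nat>\<close>, with the subclass of the base point getting the label 0.\<close>

lemma coding_infinite_branching:
  assumes x0: "x0 \<in> X"
    and branch: "\<And>i x. x \<in> X \<Longrightarrow> countable (E (Suc i) `` {x} // E i) \<and> infinite (E (Suc i) `` {x} // E i)"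
  shows "\<exists>f. f ` X = fin_seqs UNIV \<and>
             (\<forall>x\<in>X. \<forall>y\<in>X. \<forall>m. last_diff (f x) (f y) \<le> real m \<longleftrightarrow> (x, y) \<in> E m)"
proof -
  define labels where "labels i C b \<longleftrightarrow> bij_betw b (C // E i) (UNIV :: nat set) \<and>
      (E i `` {x0} \<in> C // E i \<longrightarrow> b (E i `` {x0}) = 0)" for i C b
  define b where "b i C = (SOME b. labels i C b)" for i C
  have b: "labels i (E (Suc i) `` {x}) (b i (E (Suc i) `` {x}))" if "x \<in> X" for i x
  proof -
    have "\<exists>b. labels i (E (Suc i) `` {x}) b"
      unfolding labels_def using branch[OF that, of i] by (elim conjE) (rule countable_infinite_labelling)
    then show ?thesis unfolding b_def by (rule someI_ex)
  qed
  have bij: "bij_betw (b i (E (Suc i) `` {x})) (E (Suc i) `` {x} // E i) UNIV" if "x \<in> X" for i x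
    using b[OF that] unfolding labels_def by (rule conjunct1)
  define l where "l i x = b i (E (Suc i) `` {x}) (E i `` {x})" for i x
  have self: "E i `` {x} \<in> E (Suc i) `` {x} // E i" if "x \<in> X" for i x
    using that E_refl by (intro class_subset_quotient) simp
  show ?thesis
  proof (rule coding[OF x0, where l = l])
    show "l i x = l i y" if "(x, y) \<in> E i" for i x y
      unfolding l_def class_eq[OF that] class_eq[OF E_monoD[OF that, of "Suc i", simplified]] ..
    show "(x, y) \<in> E i" if xy: "(x, y) \<in> E (Suc i)" and l: "l i x = l i y" for i x y
    proof -
      have X: "x \<in> X" "y \<in> X" using E_in xy by blast+
      have "inj_on (b i (E (Suc i) `` {x})) (E (Suc i) `` {x} // E i)"
        using bij[OF X(1)] by (rule bij_betw_imp_inj_on)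
      moreover have "E i `` {y} \<in> E (Suc i) `` {x} // E i"
        using xy by (intro class_subset_quotient) simp
      moreover have "b i (E (Suc i) `` {x}) (E i `` {x}) = b i (E (Suc i) `` {x}) (E i `` {y})"
        using l unfolding l_def class_eq[OF xy] .
      ultimately have "E i `` {x} = E i `` {y}" using self[OF X(1)] by (simp add: inj_on_eq_iff)
      then have "y \<in> E i `` {x}" using E_refl[OF X(2)] by simp
      then show ?thesis by simp
    qed
    show "l i x \<in> UNIV" for i x by simp
    show "\<exists>y. (x, y) \<in> E (Suc i) \<and> l i y = k" if "x \<in> X" for i x k
    proof -
      have "k \<in> b i (E (Suc i) `` {x}) ` (E (Suc i) `` {x} // E i)"
        using bij_betw_imp_surj_on[OF bij[OF that]] by simp
      then obtain a where a: "a \<in> E (Suc i) `` {x} // E i" "b i (E (Suc i) `` {x}) a = k" by blast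
      obtain y where y: "y \<in> E (Suc i) `` {x}" "a = E i `` {y}" using a(1) by (rule quotientE)
      have xy: "(x, y) \<in> E (Suc i)" using y(1) by simp
      have "l i y = k" using a(2) y(2) unfolding l_def class_eq[OF xy, symmetric] by simp
      then show ?thesis using xy by blast
    qed
    show "l i x0 = 0" for i
      using b[OF x0, of i] self[OF x0, of i] by (simp add: l_def labels_def)
  qed
qed

end

context metric_tower
begin

lemma countable_classes:
  assumes "separable_space (mtopology_of M)" "C \<subseteq> mspace M"
  shows "countable (C // E i)"
proof -
  obtain A where A: "countable A" "A \<subseteq> topspace (mtopology_of M)"
    "mtopology_of M closure_of A = topspace (mtopology_of M)"
    using assms(1) unfolding separable_space_def by blast
  have "C // E i \<subseteq> (\<lambda>a. E i `` {a}) ` A"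
  proof
    fix c assume "c \<in> C // E i"
    then obtain x where x: "x \<in> C" "c = E i `` {x}" by (rule quotientE)
    have "x \<in> mtopology_of M closure_of A" using A(3) x(1) assms(2) by auto
    then obtain a where a: "a \<in> A" "a \<in> mspace M" "mdist M x a < 1"
      unfolding mtopology_of_def Metric_space.metric_closure_of[OF Metric_space_mspace_mdist]
      by (auto simp: Metric_space.mball_def[OF Metric_space_mspace_mdist] dest: spec[of _ "1::real"])
    have "(x, a) \<in> E i"
      using E_monoD[OF E_unit[of x a], of i] a x assms(2) by auto
    then have "c = E i `` {a}" unfolding x(2) by (rule class_eq)
    then show "c \<in> (\<lambda>a. E i `` {a}) ` A" using a(1) by (rule image_eqI)
  qed
  then show ?thesis using countable_image[OF A(1)] by (rule countable_subset)
qed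

text \<open>If some class of level \<open>n\<close> had finitely many subclasses of level \<open>k\<close>, they would cover a ball
  that has no finite cover by sets of their diameter.\<close>

lemma infinite_branching:
  assumes "unbounded_geometry M"
  shows "\<exists>n>k. \<forall>x\<in>mspace M. infinite (E n `` {x} // E k)"
proof -
  obtain D where D: "0 < D" "\<forall>x y. (x, y) \<in> E k \<longrightarrow> mdist M x y \<le> D" using E_bounded by blast
  obtain \<epsilon> where \<epsilon>: "0 < \<epsilon>" "\<infinity> \<le> lower_cov M D \<epsilon>"
    using assms D(1) unfolding unbounded_geometry_def by blast
  obtain i where i: "\<forall>x\<in>mspace M. \<forall>y\<in>mspace M. mdist M x y \<le> \<epsilon> \<longrightarrow> (x, y) \<in> E i"
    using E_near by blast
  define n where "n = max i (Suc k)"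
  have "infinite (E n `` {x} // E k)" if x: "x \<in> mspace M" for x
  proof
    assume "finite (E n `` {x} // E k)"
    moreover have "E n `` {x} // E k = (\<lambda>r. E k `` {r}) ` (E n `` {x})" by (auto simp: quotient_def)
    ultimately obtain I where I: "finite I" "I \<subseteq> E n `` {x}"
      "(\<lambda>r. E k `` {r}) ` (E n `` {x}) = (\<lambda>r. E k `` {r}) ` I"
      using finite_subset_image[of _ "\<lambda>r. E k `` {r}" "E n `` {x}"] by (metis order_refl)
    have "cov_number M D (mcball_of M x \<epsilon>) \<le> enat (card I)"
    proof (rule cov_number_le_classes[where k = k])
      show "I \<subseteq> mspace M" using I(2) E_in by blast
      show "mcball_of M x \<epsilon> \<subseteq> (\<Union>r\<in>I. E k `` {r})"
      proof
        fix y assume "y \<in> mcball_of M x \<epsilon>"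
        then have y: "y \<in> mspace M" "mdist M x y \<le> \<epsilon>" by simp_all
        then have "(x, y) \<in> E n" using i x E_monoD[of x y i n] by (simp add: n_def)
        then have "E k `` {y} \<in> (\<lambda>r. E k `` {r}) ` I" using I(3) by blast
        moreover have "y \<in> E k `` {y}" using E_refl[OF y(1)] by simp
        ultimately show "y \<in> (\<Union>r\<in>I. E k `` {r})" by blast
      qed
    qed (use I D in auto)
    moreover have "\<infinity> \<le> cov_number M D (mcball_of M x \<epsilon>)"
      using \<epsilon>(2) x unfolding lower_cov_def by (simp add: le_INF_iff)
    ultimately show False by simp
  qed
  then show ?thesis by (intro exI[of _ n]) (auto simp: n_def)
qed

text \<open>Thinning out the tower makes all branching countably infinite, and then the digit expansion is
  a bijection between the classes of level 0 of the thinned tower and the Baire macro-space.\<close>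

lemma equivalent_baire:
  assumes ne: "mspace M \<noteq> {}" and sep: "separable_space (mtopology_of M)" and unb: "unbounded_geometry M"
  shows "macro_uniformly_equivalent M baire_macro_space"
proof -
  obtain x0 where x0: "x0 \<in> mspace M" using ne by blast
  have "\<exists>r. \<forall>i. True \<and> (r i < r (Suc i) \<and> (\<forall>x\<in>mspace M. infinite (E (r (Suc i)) `` {x} // E (r i))))"
    by (rule dependent_nat_choice) (use infinite_branching[OF unb] in auto)
  then obtain r where r: "\<And>i. r i < r (Suc i)"
    "\<And>i x. x \<in> mspace M \<Longrightarrow> infinite (E (r (Suc i)) `` {x} // E (r i))" by blast
  have mono: "strict_mono r" using r(1) by (simp add: strict_mono_Suc_iff)
  interpret sub: tower "mspace M" "\<lambda>i. E (r i)" by (rule tower_subsequence[OF mono])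
  have "countable (E (r (Suc i)) `` {x} // E (r i))" for i x
    by (rule countable_classes[OF sep]) (use E_in in blast)
  then have "\<exists>f. f ` mspace M = fin_seqs UNIV \<and>
    (\<forall>x\<in>mspace M. \<forall>y\<in>mspace M. \<forall>m. last_diff (f x) (f y) \<le> real m \<longleftrightarrow> (x, y) \<in> E (r m))"
    by (intro sub.coding_infinite_branching[OF x0] conjI r(2))
  then obtain f where f: "f ` mspace M = fin_seqs UNIV"
    "\<forall>x\<in>mspace M. \<forall>y\<in>mspace M. \<forall>m. last_diff (f x) (f y) \<le> real m \<longleftrightarrow> (x, y) \<in> E (r m)"
    by (elim exE conjE)
  show ?thesis
    unfolding baire_macro_space_def
  proof (rule equivalent_to_fin_seqs[OF f(1)])
    fix i
    have "(x, y) \<in> E (r i)" if "(x, y) \<in> E i" for x y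
      using E_monoD[OF that] strict_mono_imp_increasing[OF mono] by blast
    then show "\<exists>m::nat. \<forall>x y. (x, y) \<in> E i \<longrightarrow> last_diff (f x) (f y) \<le> real m"
      using f(2) E_in by blast
    show "\<exists>j. \<forall>x\<in>mspace M. \<forall>y\<in>mspace M. last_diff (f x) (f y) \<le> real i \<longrightarrow> (x, y) \<in> E j"
      using f(2) by blast
  qed
qed

end

section \<open>Bounded geometry\<close>

text \<open>The natural numbers with their dyadic blocks are a copy of the Cantor macro-cube, by binary
  expansion.\<close>

lemma binary_coding:
  "\<exists>\<beta>. \<beta> ` UNIV = fin_seqs {0, 1} \<and>
     (\<forall>a b m. last_diff (\<beta> a) (\<beta> b) \<le> real m \<longleftrightarrow> a div 2 ^ m = b div (2::nat) ^ m)"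
proof -
  define F :: "nat \<Rightarrow> (nat \<times> nat) set" where "F m = {(a, b). a div 2 ^ m = b div 2 ^ m}" for m
  have halve: "a div 2 ^ Suc m = a div 2 ^ m div 2" for a m :: nat
    by (simp add: div_mult2_eq[symmetric] mult.commute)
  interpret tower UNIV F
  proof
    show "equiv UNIV (F i)" for i
      by (intro equivI refl_onI symI transI) (auto simp: F_def)
    show "F i \<subseteq> F (Suc i)" for i
      by (auto simp: F_def halve simp del: power_Suc)
    fix a b :: nat
    have "a div 2 ^ (a + b) = 0" "b div 2 ^ (a + b) = 0"
      using le_less_trans[OF le_add1 less_exp, of a b] le_less_trans[OF le_add2 less_exp, of b a]
      by simp_all
    then show "\<exists>i. (a, b) \<in> F i" by (auto simp: F_def intro!: exI[of _ "a + b"])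
  qed
  have "\<exists>\<beta>. \<beta> ` UNIV = fin_seqs {0, 1} \<and>
             (\<forall>x\<in>UNIV. \<forall>y\<in>UNIV. \<forall>m. last_diff (\<beta> x) (\<beta> y) \<le> real m \<longleftrightarrow> (x, y) \<in> F m)"
  proof (rule coding[of 0 "\<lambda>i n. n div 2 ^ i mod 2"])
    show "a div 2 ^ i mod 2 = b div 2 ^ i mod 2" if "(a, b) \<in> F i" for i a b
      using that by (simp add: F_def)
    show "(a, b) \<in> F i" if "(a, b) \<in> F (Suc i)" "a div 2 ^ i mod 2 = b div 2 ^ i mod 2" for i a b
    proof -
      have "a div 2 ^ i div 2 = b div 2 ^ i div 2" using that(1) by (simp add: F_def halve del: power_Suc)
      then have "a div 2 ^ i = b div 2 ^ i" using that(2) by (metis div_mult_mod_eq)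
      then show ?thesis by (simp add: F_def)
    qed
    show "n div 2 ^ i mod 2 \<in> {0, 1}" for i n :: nat by auto
    show "\<exists>b. (a, b) \<in> F (Suc i) \<and> b div 2 ^ i mod 2 = k" if "k \<in> {0, 1}" for i a k :: nat
    proof -
      define b where "b = (2 * (a div 2 ^ Suc i) + k) * 2 ^ i"
      have b: "b div 2 ^ i = 2 * (a div 2 ^ Suc i) + k" by (simp add: b_def)
      have "b div 2 ^ Suc i = a div 2 ^ Suc i" "b div 2 ^ i mod 2 = k"
        unfolding halve[of b] b using that by auto
      then show ?thesis by (intro exI[of _ b]) (simp add: F_def)
    qed
  qed auto
  then show ?thesis by (simp add: F_def)
qed

context metric_tower
begin

lemma class_representatives:
  "\<exists>\<rho>. (\<forall>x\<in>mspace M. (x, \<rho> x) \<in> E k) \<and> (\<forall>x y. (x, y) \<in> E k \<longrightarrow> \<rho> x = \<rho> y)"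
proof (intro exI conjI ballI allI impI)
  define \<rho> where "\<rho> x = (SOME z. z \<in> E k `` {x})" for x
  show "(x, \<rho> x) \<in> E k" if "x \<in> mspace M" for x
    using someI[of "\<lambda>z. z \<in> E k `` {x}" x] E_refl[OF that] by (simp add: \<rho>_def)
  show "\<rho> x = \<rho> y" if "(x, y) \<in> E k" for x y
    unfolding \<rho>_def class_eq[OF that] ..
qed

text \<open>Representatives \<open>R\<close> of the classes at a suitable level \<open>k\<close> turn the covering numbers into
  cardinalities of classes, which have, at each level, a uniform upper bound by bounded geometry
  and, at high levels, an arbitrarily large uniform lower bound by the growth assumption.
  Therefore levels \<open>n i\<close> and block lengths \<open>2 ^ m i\<close> can be chosen in turn such that they form a
  scaled tower. The map onto the natural numbers that it provides, followed by binary expansion, is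
  the equivalence.\<close>

lemma equivalent_cantor:
  assumes ne: "mspace M \<noteq> {}" and bdd: "bounded_geometry M"
    and growth: "\<And>\<delta> n. 0 < \<delta> \<Longrightarrow> \<exists>\<epsilon>>0. \<forall>y\<in>mspace M. enat n \<le> cov_number M \<delta> (mcball_of M y \<epsilon>)"
  shows "macro_uniformly_equivalent M cantor_macro_cube"
proof -
  obtain \<delta> where \<delta>: "0 < \<delta>" "\<And>\<epsilon>. 0 < \<epsilon> \<Longrightarrow> upper_cov M \<delta> \<epsilon> < \<infinity>"
    using bdd unfolding bounded_geometry_def by blast
  obtain k where k: "\<forall>x\<in>mspace M. \<forall>y\<in>mspace M. mdist M x y \<le> \<delta> \<longrightarrow> (x, y) \<in> E k"
    using E_near by blast
  obtain \<rho> where \<rho>: "\<forall>x\<in>mspace M. (x, \<rho> x) \<in> E k" "\<forall>x y. (x, y) \<in> E k \<longrightarrow> \<rho> x = \<rho> y"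
    using class_representatives[of k] by (elim exE conjE)
  note \<rho> = \<rho>[rule_format]
  define R where "R = \<rho> ` mspace M"
  have RM: "R \<subseteq> mspace M" using \<rho>(1) E_in by (auto simp: R_def)
  have R_eq: "r = r'" if r: "r \<in> R" "r' \<in> R" "(r, r') \<in> E k" for r r'
  proof -
    obtain x x' where x: "x \<in> mspace M" "r = \<rho> x" "x' \<in> mspace M" "r' = \<rho> x'"
      using r by (auto simp: R_def)
    have "\<rho> x = \<rho> r" "\<rho> r = \<rho> r'" "\<rho> r' = \<rho> x'"
      using \<rho> x r E_sym by (metis, metis, metis)
    then show ?thesis using x by simp
  qed
  define cnt where "cnt n x = card (E n `` {x} \<inter> R)" for n x
  have upper: "\<exists>A. \<forall>x\<in>mspace M. finite (E n `` {x} \<inter> R) \<and> cnt n x \<le> A" for n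
  proof -
    obtain D where D: "0 < D" "\<forall>x y. (x, y) \<in> E n \<longrightarrow> mdist M x y \<le> D" using E_bounded by blast
    obtain N where N: "upper_cov M \<delta> D = enat N" using \<delta>(2)[OF D(1)] by (cases "upper_cov M \<delta> D") auto
    have "finite (E n `` {x} \<inter> R) \<and> cnt n x \<le> N" if x: "x \<in> mspace M" for x
    proof (rule ccontr)
      assume "\<not> ?thesis"
      then have big: "infinite (E n `` {x} \<inter> R) \<or> enat (Suc N) \<le> enat (card (E n `` {x} \<inter> R))"
        by (auto simp: cnt_def)
      have "enat (Suc N) \<le> cov_number M \<delta> (mcball_of M x D)"
      proof (rule separated_le_cov_number[OF _ _ _ big])
        show "E n `` {x} \<inter> R \<subseteq> mcball_of M x D" using D(2) x RM by auto
        show "0 \<le> \<delta>" using \<delta>(1) by simp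
        fix y z assume yz: "y \<in> E n `` {x} \<inter> R" "z \<in> E n `` {x} \<inter> R" "mdist M y z \<le> \<delta>"
        then have "(y, z) \<in> E k" using k RM by blast
        then show "y = z" using R_eq yz by blast
      qed
      also have "\<dots> \<le> upper_cov M \<delta> D" unfolding upper_cov_def by (rule SUP_upper[OF x])
      finally show False using N by simp
    qed
    then show ?thesis by blast
  qed
  have finR: "finite (E n `` {x} \<inter> R)" if "x \<in> mspace M" for n x
    using upper[of n] that by blast
  have lower: "\<exists>n\<ge>n0. k \<le> n \<and> (\<forall>x\<in>mspace M. a \<le> cnt n x)" for n0 a
  proof -
    obtain D where D: "0 < D" "\<forall>x y. (x, y) \<in> E k \<longrightarrow> mdist M x y \<le> D" using E_bounded by blast
    obtain \<epsilon> where \<epsilon>: "0 < \<epsilon>" "\<forall>y\<in>mspace M. enat a \<le> cov_number M D (mcball_of M y \<epsilon>)"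
      using growth[OF D(1), of a] by blast
    obtain i where i: "\<forall>x\<in>mspace M. \<forall>y\<in>mspace M. mdist M x y \<le> \<epsilon> \<longrightarrow> (x, y) \<in> E i"
      using E_near by blast
    define n where "n = Max {i, k, n0}"
    have n: "i \<le> n" "k \<le> n" "n0 \<le> n" by (auto simp: n_def)
    have "a \<le> cnt n x" if x: "x \<in> mspace M" for x
    proof -
      have "cov_number M D (mcball_of M x \<epsilon>) \<le> enat (cnt n x)"
        unfolding cnt_def
      proof (rule cov_number_le_classes[where k = k])
        show "mcball_of M x \<epsilon> \<subseteq> (\<Union>r\<in>E n `` {x} \<inter> R. E k `` {r})"
        proof
          fix y assume "y \<in> mcball_of M x \<epsilon>"
          then have y: "y \<in> mspace M" "mdist M x y \<le> \<epsilon>" by simp_all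
          have "(x, y) \<in> E n" using i x y E_monoD[of x y i n] n by blast
          then have "(x, \<rho> y) \<in> E n" using E_trans[of x y n] E_monoD[OF \<rho>(1)[OF y(1)] n(2)] by blast
          moreover have "\<rho> y \<in> R" using y by (simp add: R_def)
          moreover have "(\<rho> y, y) \<in> E k" using E_sym[OF \<rho>(1)[OF y(1)]] .
          ultimately show "y \<in> (\<Union>r\<in>E n `` {x} \<inter> R. E k `` {r})" by blast
        qed
      qed (use D finR[OF x] RM in auto)
      moreover have "enat a \<le> cov_number M D (mcball_of M x \<epsilon>)" using \<epsilon>(2) x by blast
      ultimately have "enat a \<le> enat (cnt n x)" by (rule order_trans[rotated])
      then show ?thesis by simp
    qed
    then show ?thesis using n by blast
  qed
  have fine: "\<exists>n\<ge>n0. k \<le> n \<and> (\<forall>x\<in>mspace M. 2 ^ m \<le> slack i * real (cnt n x))" for n0 m i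
  proof -
    define a where "a = nat \<lceil>2 ^ m / slack i\<rceil>"
    obtain n where n: "n0 \<le> n" "k \<le> n" "\<forall>x\<in>mspace M. a \<le> cnt n x" using lower[of n0 a] by blast
    have "2 ^ m \<le> slack i * real (cnt n x)" if "x \<in> mspace M" for x
    proof -
      have "2 ^ m / slack i \<le> real a" unfolding a_def by (rule real_nat_ceiling_ge)
      also have "\<dots> \<le> real (cnt n x)" using n(3) that by simp
      finally show ?thesis using slack_pos[of i] by (simp add: pos_divide_le_eq mult.commute)
    qed
    then show ?thesis using n by blast
  qed
  have coarse: "\<exists>m>m0. \<forall>x\<in>mspace M. 2 * real (cnt n x) \<le> slack i * 2 ^ m" for m0 n i
  proof -
    obtain A where A: "\<forall>x\<in>mspace M. cnt n x \<le> A" using upper[of n] by blast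
    obtain m1 where m1: "2 * real A / slack i < 2 ^ m1"
      using real_arch_pow[of 2 "2 * real A / slack i"] by auto
    define m where "m = max m1 (Suc m0)"
    have "2 * real (cnt n x) \<le> slack i * 2 ^ m" if "x \<in> mspace M" for x
    proof -
      have "2 * real (cnt n x) \<le> 2 * real A" using A that by simp
      also have "\<dots> \<le> slack i * 2 ^ m1" using m1 slack_pos[of i] by (simp add: pos_divide_less_eq mult.commute)
      also have "\<dots> \<le> slack i * 2 ^ m"
        using slack_pos[of i] by (intro mult_left_mono power_increasing) (auto simp: m_def)
      finally show ?thesis .
    qed
    then show ?thesis by (intro exI[of _ m]) (auto simp: m_def)
  qed
  \<comment> \<open>Alternate the two choices: a block length much larger than the classes of the current level,
    then a level whose classes are much larger than the blocks.\<close>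
  have "\<exists>s. \<forall>i. (k \<le> fst (s i) \<and> (i = 0 \<longrightarrow> snd (s i) = 0) \<and>
          (\<forall>x\<in>mspace M. 2 ^ snd (s i) \<le> slack i * real (cnt (fst (s i)) x))) \<and>
        (fst (s i) < fst (s (Suc i)) \<and> snd (s i) < snd (s (Suc i)) \<and>
          (\<forall>x\<in>mspace M. 2 * real (cnt (fst (s i)) x) \<le> slack i * 2 ^ snd (s (Suc i))))"
  proof (rule dependent_nat_choice)
    obtain n where "k \<le> n" "\<forall>x\<in>mspace M. 2 ^ 0 \<le> slack 0 * real (cnt n x)" using fine[of 0 0 0] by blast
    then show "\<exists>s. k \<le> fst s \<and> (0 = (0::nat) \<longrightarrow> snd s = 0) \<and>
          (\<forall>x\<in>mspace M. 2 ^ snd s \<le> slack 0 * real (cnt (fst s) x))"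
      by (intro exI[of _ "(n, 0)"]) simp
    fix s :: "nat \<times> nat" and i
    obtain m where m: "snd s < m" "\<forall>x\<in>mspace M. 2 * real (cnt (fst s) x) \<le> slack i * 2 ^ m"
      using coarse by blast
    obtain n where n: "Suc (fst s) \<le> n" "k \<le> n" "\<forall>x\<in>mspace M. 2 ^ m \<le> slack (Suc i) * real (cnt n x)"
      using fine by blast
    show "\<exists>t. (k \<le> fst t \<and> (Suc i = 0 \<longrightarrow> snd t = 0) \<and>
          (\<forall>x\<in>mspace M. 2 ^ snd t \<le> slack (Suc i) * real (cnt (fst t) x))) \<and>
        (fst s < fst t \<and> snd s < snd t \<and>
          (\<forall>x\<in>mspace M. 2 * real (cnt (fst s) x) \<le> slack i * 2 ^ snd t))"
      using m n by (intro exI[of _ "(n, m)"]) simp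
  qed
  then obtain s where s: "\<forall>i. (k \<le> fst (s i) \<and> (i = 0 \<longrightarrow> snd (s i) = 0) \<and>
          (\<forall>x\<in>mspace M. 2 ^ snd (s i) \<le> slack i * real (cnt (fst (s i)) x))) \<and>
        (fst (s i) < fst (s (Suc i)) \<and> snd (s i) < snd (s (Suc i)) \<and>
          (\<forall>x\<in>mspace M. 2 * real (cnt (fst (s i)) x) \<le> slack i * 2 ^ snd (s (Suc i))))" ..
  define n where "n i = fst (s i)" for i
  define m where "m i = snd (s i)" for i
  have nm: "k \<le> n i" "m 0 = 0" "n i < n (Suc i)" "m i < m (Suc i)"
    and size: "x \<in> mspace M \<Longrightarrow> 2 ^ m i \<le> slack i * real (cnt (n i) x)"
      "x \<in> mspace M \<Longrightarrow> 2 * real (cnt (n i) x) \<le> slack i * 2 ^ m (Suc i)" for i x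
    using s by (simp_all add: n_def m_def)
  have mono: "strict_mono n" "strict_mono m" using nm by (simp_all add: strict_mono_Suc_iff)
  interpret sub: tower "mspace M" "\<lambda>i. E (n i)" by (rule tower_subsequence[OF mono(1)])
  have class_R: "(E (n i) \<inter> R \<times> R) `` {x} = E (n i) `` {x} \<inter> R" if "x \<in> R" for i x
    using that by blast
  have scaled: "scaled_tower R (\<lambda>i. E (n i) \<inter> R \<times> R) (\<lambda>i. 2 ^ m i)"
  proof (intro scaled_tower.intro sub.tower_restrict[OF RM] scaled_tower_axioms.intro)
    fix i x assume x: "x \<in> R"
    then have xM: "x \<in> mspace M" using RM by blast
    show "finite ((E (n i) \<inter> R \<times> R) `` {x})" unfolding class_R[OF x] by (rule finR[OF xM])
    show "real (2 ^ m i) \<le> slack i * real (card ((E (n i) \<inter> R \<times> R) `` {x}))"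
      unfolding class_R[OF x] using size(1)[OF xM, of i] by (simp add: cnt_def)
    show "real (2 * card ((E (n i) \<inter> R \<times> R) `` {x})) \<le> slack i * real (2 ^ m (Suc i))"
      unfolding class_R[OF x] using size(2)[OF xM, of i] by (simp add: cnt_def)
  next
    show "(2::nat) ^ m i dvd 2 ^ m (Suc i)" for i
      by (rule le_imp_power_dvd) (simp add: nm less_imp_le)
  qed (simp_all add: nm)
  obtain x0 where "x0 \<in> R" using ne by (auto simp: R_def)
  have "\<exists>h :: 'a \<Rightarrow> nat. h ` R = UNIV \<and> (\<forall>i. \<forall>x\<in>R. \<forall>y\<in>R.
     ((x, y) \<in> E (n i) \<inter> R \<times> R \<longrightarrow> h x div 2 ^ m (Suc i) = h y div 2 ^ m (Suc i)) \<and>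
     (h x div 2 ^ m (Suc i) = h y div 2 ^ m (Suc i) \<longrightarrow> (x, y) \<in> E (n (Suc i)) \<inter> R \<times> R))"
    using \<open>x0 \<in> R\<close> by (rule scaled_tower.dyadic_coding[OF scaled])
  then obtain h :: "'a \<Rightarrow> nat" where h: "h ` R = UNIV" "\<forall>i. \<forall>x\<in>R. \<forall>y\<in>R.
     ((x, y) \<in> E (n i) \<inter> R \<times> R \<longrightarrow> h x div 2 ^ m (Suc i) = h y div 2 ^ m (Suc i)) \<and>
     (h x div 2 ^ m (Suc i) = h y div 2 ^ m (Suc i) \<longrightarrow> (x, y) \<in> E (n (Suc i)) \<inter> R \<times> R)"
    by (elim exE conjE)
  obtain \<beta> where \<beta>: "\<beta> ` UNIV = fin_seqs {0, 1}"
     "\<forall>a b m. last_diff (\<beta> a) (\<beta> b) \<le> real m \<longleftrightarrow> a div 2 ^ m = b div (2::nat) ^ m"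
    using binary_coding by (elim exE conjE)
  define f where "f x = \<beta> (h (\<rho> x))" for x
  have rep: "(x, y) \<in> E j \<longleftrightarrow> (\<rho> x, \<rho> y) \<in> E j" if xy: "x \<in> mspace M" "y \<in> mspace M" and "k \<le> j" for x y j
  proof -
    have x: "(x, \<rho> x) \<in> E j" and y: "(y, \<rho> y) \<in> E j"
      using E_monoD[OF \<rho>(1) \<open>k \<le> j\<close>] xy by auto
    show ?thesis
      using E_trans[OF E_trans[OF E_sym[OF x]] y] E_trans[OF E_trans[OF x] E_sym[OF y]] by blast
  qed
  have \<rho>R: "\<rho> x \<in> R" if "x \<in> mspace M" for x using that by (simp add: R_def)
  show ?thesis
    unfolding cantor_macro_cube_def
  proof (rule equivalent_to_fin_seqs)
    have "f ` mspace M = \<beta> ` h ` R" by (auto simp: f_def R_def)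
    then show "f ` mspace M = fin_seqs {0, 1}" using h(1) \<beta>(1) by simp
    fix i
    have "last_diff (f x) (f y) \<le> real (m (Suc i))" if xy: "(x, y) \<in> E i" for x y
    proof -
      have M: "x \<in> mspace M" "y \<in> mspace M" using E_in[OF xy] by auto
      have "i \<le> n i" by (rule strict_mono_imp_increasing[OF mono(1)])
      then have "(x, y) \<in> E (n i)" by (rule E_monoD[OF xy])
      then have "(\<rho> x, \<rho> y) \<in> E (n i) \<inter> R \<times> R" using rep[OF M nm(1)] \<rho>R M by blast
      then show ?thesis unfolding f_def \<beta>(2)[rule_format] using h(2) by blast
    qed
    then show "\<exists>j::nat. \<forall>x y. (x, y) \<in> E i \<longrightarrow> last_diff (f x) (f y) \<le> real j" by blast
    have "(x, y) \<in> E (n (Suc i))"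
      if xy: "x \<in> mspace M" "y \<in> mspace M" and d: "last_diff (f x) (f y) \<le> real i" for x y
    proof -
      have "i \<le> m (Suc i)" using strict_mono_imp_increasing[OF mono(2), of "Suc i"] by simp
      then have "last_diff (f x) (f y) \<le> real (m (Suc i))" using d by linarith
      then have "h (\<rho> x) div 2 ^ m (Suc i) = h (\<rho> y) div 2 ^ m (Suc i)"
        unfolding f_def \<beta>(2)[rule_format] .
      then have "(\<rho> x, \<rho> y) \<in> E (n (Suc i))" using h(2) \<rho>R xy by blast
      then show ?thesis using rep[OF xy nm(1)] by blast
    qed
    then show "\<exists>j. \<forall>x\<in>mspace M. \<forall>y\<in>mspace M. last_diff (f x) (f y) \<le> real i \<longrightarrow> (x, y) \<in> E j" by blast
  qed
qed

end

section \<open>The classification\<close>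

theorem theorem1:
  fixes X :: "'a metric"
  assumes "mspace X \<noteq> {}"
    and "coarsely_homogeneous X"
    and "separable_space (mtopology_of X)"
    and "asymptotic_dimension_zero X"
  shows "(macro_uniformly_equivalent X singleton_metric \<or>
          macro_uniformly_equivalent X cantor_macro_cube \<or>
          macro_uniformly_equivalent X baire_macro_space) \<and>
         (macro_uniformly_equivalent X singleton_metric \<longleftrightarrow> bounded_metric X) \<and>
         (macro_uniformly_equivalent X cantor_macro_cube \<longleftrightarrow>
            \<not> bounded_metric X \<and> bounded_geometry X) \<and>
         (macro_uniformly_equivalent X baire_macro_space \<longleftrightarrow> unbounded_geometry X)"
proof -
  obtain E where "metric_tower X E" using component_tower[OF assms(4)] by blast
  then interpret metric_tower X E .
  obtain x0 where x0: "x0 \<in> mspace X" using assms(1) by blast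
  have single: "macro_uniformly_equivalent X singleton_metric \<longleftrightarrow> bounded_metric X"
    using bounded_equivalent_singleton[OF assms(1)] bounded_metric_transfer[of X singleton_metric]
    by (auto simp: bounded_metric_iff)
  have cantor: "macro_uniformly_equivalent X cantor_macro_cube"
    if "\<not> bounded_metric X" "bounded_geometry X"
    using equivalent_cantor[OF assms(1) that(2)] homogeneous_growth[OF assms(2) that(1) x0] by blast
  have cantor': "\<not> bounded_metric X \<and> bounded_geometry X"
    if "macro_uniformly_equivalent X cantor_macro_cube"
  proof -
    have "macro_uniformly_equivalent cantor_macro_cube X"
      using that macro_uniform_equivalence_converse unfolding macro_uniformly_equivalent_def by blast
    then show ?thesis
      using bounded_metric_transfer unbounded_cantor bounded_geometry_transfer[OF that bounded_geometry_cantor]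
      by blast
  qed
  have baire: "macro_uniformly_equivalent X baire_macro_space \<longleftrightarrow> unbounded_geometry X"
    using equivalent_baire[OF assms(1,3)] unbounded_geometry_transfer unbounded_geometry_baire by blast
  show ?thesis
    using single cantor cantor' baire homogeneous_dichotomy[OF assms(2)] by blast
qed

end
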